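(* There are absolute constants $C,c>0$ such that for all integers $1\le k\le n$, every $\epsilon>0$ and every explicitly known distribution $q$ on $[n]$, there is a randomized algorithm that draws at most $$C\,\frac{\sqrt{nk}}{\epsilon^{3.5}}\,\log^{c}\!\left(2+n+\tfrac1\epsilon\right)$$ i.i.d. samples from an unknown distribution $p$ on $[n]$ (i.e. $\widetilde O(\sqrt{nk}/\epsilon^{3.5})$ samples) and satisfies: (1) if there exist $\alpha^*\in[0,1]$ and a $k$-flat distribution $r^*$ on $[n]$ with $p=(1-\alpha^* )q+\alpha^* r^*$, then it outputs accept with probability at least $2/3$; (2) if $\|p-((1-\alpha)q+\alpha r)\|_1\ge\epsilon$ for every $\alpha\in[0,1]$ and every $k$-flat distribution $r$ on $[n]$, then it outputs reject with probability at least $2/3$.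
   Context: $[n]=\{1,\dots,n\}$. A $k$-segmentation of $[n]$ is a collection of $k$ disjoint intervals $I_1,\dots,I_k$ covering $[n]$. A function $f:[n]\to\mathbb R$ is $k$-flat if there is a $k$-segmentation of $[n]$ such that $f$ is constant on each of its intervals; a distribution is $k$-flat if its probability mass function is $k$-flat. Explicitly known means that the algorithm may depend arbitrarily on $q$ (and $n,k,\epsilon$); neither $\alpha^*$, $r^*$ nor its segmentation is given to the algorithm. $\widetilde O$ hides factors polylogarithmic in $n$ and $1/\epsilon$. *)

theory Defs
  imports "HOL-Probability.Probability" "HOL-Library.Disjoint_Sets"
begin

(* partition_on forces the intervals to be nonempty. For 1 <= k <= n, admitting empty
   intervals would not change which functions are k-flat. *)
definition segmentation :: "nat \<Rightarrow> nat \<Rightarrow> nat set set \<Rightarrow> bool" where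
  "segmentation n k P \<longleftrightarrow>
     partition_on {1..n} P \<and> card P = k \<and> (\<forall>J\<in>P. \<exists>a b. J = {a..b})"

definition flat :: "nat \<Rightarrow> nat \<Rightarrow> (nat \<Rightarrow> real) \<Rightarrow> bool" where
  "flat n k f \<longleftrightarrow> (\<exists>P. segmentation n k P \<and> (\<forall>J\<in>P. f constant_on J))"

definition dist_on :: "nat \<Rightarrow> nat pmf \<Rightarrow> bool" where
  "dist_on n p \<longleftrightarrow> set_pmf p \<subseteq> {1..n}"

definition flat_dist :: "nat \<Rightarrow> nat \<Rightarrow> nat pmf \<Rightarrow> bool" where
  "flat_dist n k r \<longleftrightarrow> dist_on n r \<and> flat n k (pmf r)"

definition mix :: "real \<Rightarrow> nat pmf \<Rightarrow> nat pmf \<Rightarrow> nat \<Rightarrow> real" where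
  "mix \<alpha> q r i = (1 - \<alpha>) * pmf q i + \<alpha> * pmf r i"

definition l1_norm :: "nat \<Rightarrow> (nat \<Rightarrow> real) \<Rightarrow> real" where
  "l1_norm n f = (\<Sum>i\<in>{1..n}. \<bar>f i\<bar>)"

datatype verdict = Accept | Reject

(* A randomized algorithm with a budget of m samples maps the list of the m samples to a
   distribution over verdicts, which accounts for its internal randomness. An algorithm
   that stops early is covered: it ignores the remaining samples. *)
type_synonym tester = "nat list \<Rightarrow> verdict pmf"

definition run_tester :: "nat \<Rightarrow> tester \<Rightarrow> nat pmf \<Rightarrow> verdict pmf" where
  "run_tester m A p = bind_pmf (replicate_pmf m p) A"

end

theory Submission
  imports Defs "HOL-Computational_Algebra.Formal_Power_Series"
begin

text \<open>
  The class of mixtures \<open>(1 - \<alpha>) q + \<alpha> r\<close> has few degrees of freedom: a \<open>k\<close>-flat \<open>r\<close> is given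
  by \<open>k\<close> intervals and \<open>k\<close> heights. Hence, up to an \<open>\<ell>\<^sub>1\<close> error polynomially small in the number
  \<open>m\<close> of samples, it is covered by a finite set of mixtures whose cardinality has a logarithm of
  order \<open>k log (n m)\<close> (\<open>mixtures_cover\<close>). It is therefore enough to test identity to each member
  \<open>h\<close> of the cover and to accept if one of the tests accepts. A true mixture needs a single test to
  accept, and a distribution far from all mixtures is rejected by a union bound, provided that each
  identity test errs with probability \<open>\<delta>\<close> inverse to the size of the cover. Repeating a
  constant-error test would cost a factor \<open>log (1/\<delta>)\<close>, that is a factor of order \<open>k\<close>; a test with
  exponential tail bounds costs, as long as \<open>m \<le> n\<close>, only about \<open>sqrt (n log (1/\<delta>)) / \<epsilon>\<^sup>2\<close> samples,
  which is where the \<open>sqrt (n k)\<close> comes from.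

  The identity test for \<open>h\<close> first splits every symbol at random into bins, so that under \<open>h\<close> no bin
  has an expected count \<open>\<nu>\<close> above \<open>1\<close>. It then adds up a bounded function of each bin count that
  only distinguishes the values \<open>0\<close>, \<open>1\<close> and \<open>\<ge> 2\<close>, chosen so that its expectation under a Poisson
  count of rate \<open>\<mu>\<close> is minimal, and zero, at \<open>\<mu> = \<nu>\<close>. Capping the counts does not hurt: half of the
  \<open>\<ell>\<^sub>1\<close> distance sits on bins that are too light, and there the expectation grows
  quadratically in \<open>\<nu> - \<mu>\<close>. Because the summands are bounded, Chernoff's method works in both
  directions once the counts are treated as independent Poisson variables, which
  \<open>expectation_prod_count_le_poisson\<close> justifies at the cost of a harmless factor of order \<open>m\<close>. The
  resulting error bound is \<open>accept_score_errors\<close>.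

  The bins have an expected count of at most \<open>1\<close> only if there are at least \<open>m\<close> of them, and this
  makes the test good enough only for \<open>k \<le> n \<epsilon>\<close> (\<open>cover_tester\<close>, \<open>main_regime_error\<close>). For
  \<open>k > n \<epsilon>\<close> the sample budget is at least of order \<open>n / \<epsilon>\<^sup>2\<close>, and the empirical distribution is
  close enough to \<open>p\<close> to decide directly (\<open>learning_tester\<close>). For \<open>\<epsilon> > 2\<close> no distribution can be
  far from an existing mixture, and no samples are drawn.
\<close>

section \<open>Multinomial counts and Poisson counts\<close>

lemma finite_set_replicate_pmf:
  assumes "finite (set_pmf p)"
  shows "finite (set_pmf (replicate_pmf m p))"
proof -
  have "set_pmf (replicate_pmf m p) = {xs. set xs \<subseteq> set_pmf p \<and> length xs = m}"
    by (auto simp: set_replicate_pmf in_lists_conv_set)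
  then show ?thesis
    using finite_lists_length_eq[OF assms] by simp
qed

lemma expectation_replicate_Suc:
  fixes h :: "'a list \<Rightarrow> real"
  assumes "finite S" "set_pmf p \<subseteq> S"
  shows "measure_pmf.expectation (replicate_pmf (Suc m) p) h =
    (\<Sum>a\<in>S. pmf p a * measure_pmf.expectation (replicate_pmf m p) (\<lambda>xs. h (a # xs)))"
proof -
  have fin: "finite (set_pmf (replicate_pmf m p))"
    by (rule finite_set_replicate_pmf) (use assms finite_subset in blast)
  have "replicate_pmf (Suc m) p = bind_pmf p (\<lambda>a. map_pmf ((#) a) (replicate_pmf m p))"
    by (simp add: map_pmf_def)
  then show ?thesis
    using assms fin by (simp add: pmf_expectation_bind[of S])
qed

lemma fps_deriv_prod:
  fixes F :: "'i \<Rightarrow> 'a::comm_ring_1 fps"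
  assumes "finite S"
  shows "fps_deriv (\<Prod>i\<in>S. F i) = (\<Sum>s\<in>S. fps_deriv (F s) * (\<Prod>i\<in>S - {s}. F i))"
  using assms
proof (induction S rule: finite_induct)
  case (insert x S)
  have eq: "(\<Prod>i\<in>insert x S - {s}. F i) = F x * (\<Prod>i\<in>S - {s}. F i)" if "s \<in> S" for s
  proof -
    have "insert x S - {s} = insert x (S - {s})" using insert that by auto
    then show ?thesis using insert by simp
  qed
  have "(\<Sum>s\<in>S. fps_deriv (F s) * (\<Prod>i\<in>insert x S - {s}. F i))
      = F x * (\<Sum>s\<in>S. fps_deriv (F s) * (\<Prod>i\<in>S - {s}. F i))"
    by (simp add: eq sum_distrib_left mult_ac)
  then show ?case using insert by (simp add: algebra_simps)
qed simp

text \<open>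
  For \<open>g = (\<lambda>_. 1)\<close> this is \<open>exp (w X)\<close>; in general, its value at \<open>t\<close> is \<open>exp (w t)\<close> times the
  expectation of \<open>g\<close> under a Poisson variable of rate \<open>w t\<close>.
\<close>
definition count_gf :: "real \<Rightarrow> (nat \<Rightarrow> real) \<Rightarrow> real fps" where
  "count_gf w g = Abs_fps (\<lambda>x. g x * w ^ x / fact x)"

lemma fps_deriv_count_gf:
  "fps_deriv (count_gf w g) = fps_const w * count_gf w (\<lambda>x. g (Suc x))"
proof (rule fps_ext)
  fix x
  have "(1 + real x) * (g (Suc x) * (w * w ^ x)) / ((1 + real x) * fact x) = g (Suc x) * (w * w ^ x) / fact x"
    by (subst mult_divide_mult_cancel_left) auto
  then show "fps_nth (fps_deriv (count_gf w g)) x = fps_nth (fps_const w * count_gf w (\<lambda>x. g (Suc x))) x"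
    by (simp add: count_gf_def mult_ac)
qed

text \<open>
  Induction on the number of samples, with the functions \<open>g i\<close> generalised: drawing one more symbol
  \<open>s\<close> shifts the argument of \<open>g s\<close>, which is what differentiation does to the generating function.
  So the recursion over the first sample is the product rule read off at one coefficient.
\<close>
lemma expectation_prod_count_eq_coeff:
  fixes g :: "'a \<Rightarrow> nat \<Rightarrow> real"
  assumes "finite S" "set_pmf p \<subseteq> S"
  shows "measure_pmf.expectation (replicate_pmf m p) (\<lambda>xs. \<Prod>i\<in>S. g i (count_list xs i))
       = fact m * fps_nth (\<Prod>i\<in>S. count_gf (pmf p i) (g i)) m"
proof (induction m arbitrary: g)
  case 0
  have "fps_nth (\<Prod>i\<in>S. count_gf (pmf p i) (g i)) 0 = (\<Prod>i\<in>S. g i 0)"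
    using assms(1) by (induction S rule: finite_induct) (auto simp: count_gf_def)
  then show ?case by simp
next
  case (Suc m)
  define g' where "g' s i x = g i (if i = s then Suc x else x)" for s i x
  have cnt: "(\<Prod>i\<in>S. g i (count_list (s # xs) i)) = (\<Prod>i\<in>S. g' s i (count_list xs i))" for s xs
    by (intro prod.cong) (auto simp: g'_def)
  have split: "(\<Prod>i\<in>S. count_gf (pmf p i) (g' s i))
      = count_gf (pmf p s) (\<lambda>x. g s (Suc x)) * (\<Prod>i\<in>S - {s}. count_gf (pmf p i) (g i))"
    if "s \<in> S" for s
  proof -
    have "g' s s = (\<lambda>x. g s (Suc x))" "\<And>i. i \<noteq> s \<Longrightarrow> g' s i = g i"
      by (auto simp: g'_def)
    then show ?thesis
      using assms(1) that by (subst prod.remove[of S s]) (auto intro!: prod.cong)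
  qed
  have "measure_pmf.expectation (replicate_pmf (Suc m) p) (\<lambda>xs. \<Prod>i\<in>S. g i (count_list xs i))
      = (\<Sum>s\<in>S. pmf p s * (fact m * fps_nth (\<Prod>i\<in>S. count_gf (pmf p i) (g' s i)) m))"
    unfolding expectation_replicate_Suc[OF assms] cnt by (subst Suc.IH) (rule refl)
  also have "\<dots> = fact m * fps_nth (\<Sum>s\<in>S. fps_deriv (count_gf (pmf p s) (g s)) *
      (\<Prod>i\<in>S - {s}. count_gf (pmf p i) (g i))) m"
    by (auto simp: fps_sum_nth sum_distrib_left split fps_deriv_count_gf mult.assoc mult.left_commute intro!: sum.cong)
  also have "\<dots> = fact m * fps_nth (fps_deriv (\<Prod>i\<in>S. count_gf (pmf p i) (g i))) m"
    by (simp only: fps_deriv_prod[OF assms(1)])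
  also have "\<dots> = fact (Suc m) * fps_nth (\<Prod>i\<in>S. count_gf (pmf p i) (g i)) (Suc m)"
    by (simp add: mult_ac)
  finally show ?case .
qed

text \<open>
  Truncated evaluation, so that bounding one coefficient of a product of nonnegative series needs no
  convergence argument.
\<close>
definition fps_partial :: "nat \<Rightarrow> real \<Rightarrow> real fps \<Rightarrow> real" where
  "fps_partial M t F = (\<Sum>x\<le>M. fps_nth F x * t ^ x)"

lemma fps_partial_mult_le:
  assumes "\<And>x. fps_nth F x \<ge> 0" "\<And>x. fps_nth G x \<ge> 0" "t \<ge> 0"
  shows "fps_partial M t (F * G) \<le> fps_partial M t F * fps_partial M t G"
proof -
  have "fps_partial M t (F * G) = (\<Sum>n\<le>M. \<Sum>i\<le>n. (fps_nth F i * t ^ i) * (fps_nth G (n - i) * t ^ (n - i)))"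
    unfolding fps_partial_def fps_mult_nth atLeast0AtMost sum_distrib_right
    by (intro sum.cong refl) (simp add: power_add[symmetric] mult_ac)
  also have "\<dots> = (\<Sum>(i,j)\<in>{(i,j). i + j \<le> M}. (fps_nth F i * t ^ i) * (fps_nth G j * t ^ j))"
    by (rule sum.triangle_reindex_eq[symmetric])
  also have "\<dots> \<le> (\<Sum>(i,j)\<in>{..M} \<times> {..M}. (fps_nth F i * t ^ i) * (fps_nth G j * t ^ j))"
    by (intro sum_mono2) (auto simp: assms)
  also have "\<dots> = fps_partial M t F * fps_partial M t G"
    by (simp add: fps_partial_def sum_product sum.cartesian_product)
  finally show ?thesis .
qed

lemma fps_partial_prod_le:
  assumes "finite S" "\<And>i x. i \<in> S \<Longrightarrow> fps_nth (F i) x \<ge> 0" "t \<ge> 0"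
  shows "(\<forall>x. fps_nth (\<Prod>i\<in>S. F i) x \<ge> 0) \<and>
    fps_partial M t (\<Prod>i\<in>S. F i) \<le> (\<Prod>i\<in>S. fps_partial M t (F i))"
  using assms(1,2)
proof (induction S rule: finite_induct)
  case empty
  have "fps_partial M t 1 = (\<Sum>x\<in>{0}. fps_nth 1 x * t ^ x)"
    unfolding fps_partial_def by (rule sum.mono_neutral_right) auto
  then show ?case by simp
next
  case (insert i S)
  have nn: "fps_partial M t (F i) \<ge> 0"
    unfolding fps_partial_def using insert assms by (intro sum_nonneg mult_nonneg_nonneg) auto
  have "fps_partial M t (F i * (\<Prod>i\<in>S. F i)) \<le> fps_partial M t (F i) * fps_partial M t (\<Prod>i\<in>S. F i)"
    using insert assms by (intro fps_partial_mult_le) auto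
  also have "\<dots> \<le> fps_partial M t (F i) * (\<Prod>i\<in>S. fps_partial M t (F i))"
    using insert nn by (intro mult_left_mono) auto
  finally show ?case
    using insert by (auto simp: fps_mult_nth intro!: sum_nonneg)
qed

text \<open>
  A weak form of Stirling's bound: a Poisson variable of rate \<open>m\<close> takes the value \<open>m\<close> with
  probability at least \<open>1 / (e m)\<close>.
\<close>
lemma fact_le_mode:
  assumes "m \<ge> 1"
  shows "fact m * exp (real m) \<le> exp 1 * real m * real m ^ m"
  using assms
proof (induction m rule: nat_induct_at_least)
  case (Suc m)
  have m: "real m > 0" using Suc by simp
  have "ln (real m / (1 + real m)) \<le> real m / (1 + real m) - 1"
    using m by (intro ln_le_minus_one) auto
  also have "\<dots> = - (1 / (1 + real m))" using m by (simp add: field_simps)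
  finally have "1 \<le> - (1 + real m) * ln (real m / (1 + real m))"
    using m by (simp add: field_simps)
  also have "\<dots> = ln (((1 + real m) / real m) ^ Suc m)"
    using m by (subst ln_realpow) (simp_all add: ln_div algebra_simps)
  finally have "exp 1 \<le> exp (ln (((1 + real m) / real m) ^ Suc m))" by (simp only: exp_le_cancel_iff)
  also have "\<dots> = ((1 + real m) / real m) ^ Suc m" using m by (subst exp_ln) auto
  finally have "exp 1 * real m ^ Suc m \<le> (1 + real m) ^ Suc m"
    using m by (simp add: power_divide field_simps)
  then have "exp 1 * (real m * real m ^ m) \<le> (1 + real m) ^ Suc m" by simp
  have "fact (Suc m) * exp (real (Suc m)) = (1 + real m) * exp 1 * (fact m * exp (real m))"
    by (simp add: exp_add)
  also have "\<dots> \<le> (1 + real m) * exp 1 * (exp 1 * real m * real m ^ m)"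
    using Suc.IH by (intro mult_left_mono) auto
  also have "\<dots> = (1 + real m) * exp 1 * (exp 1 * (real m * real m ^ m))" by simp
  also have "\<dots> \<le> (1 + real m) * exp 1 * (1 + real m) ^ Suc m"
    using \<open>exp 1 * (real m * real m ^ m) \<le> (1 + real m) ^ Suc m\<close> by (intro mult_left_mono) auto
  finally show ?case by (simp add: mult_ac)
qed simp

lemma sum_exp_tail_le:
  fixes \<mu> :: real
  assumes "\<mu> \<ge> 0" "\<And>x. x \<ge> 2 \<Longrightarrow> g x = g 2" "\<And>x. g x \<ge> 0"
  shows "(\<Sum>x\<le>M. g x * \<mu> ^ x / fact x) \<le> g 0 + g 1 * \<mu> + g 2 * (exp \<mu> - 1 - \<mu>)"
proof -
  let ?f = "\<lambda>x. g x * \<mu> ^ x / fact x"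
  have "(\<Sum>x\<le>M. ?f x) \<le> (\<Sum>x<M+2. ?f x)"
    by (rule sum_mono2) (use assms in auto)
  also have "{..<M+2} = insert 0 (insert 1 ((\<lambda>x. x + 2) ` {..<M}))"
  proof -
    have "x \<in> (\<lambda>x. x + 2) ` {..<M}" if "x < M + 2" "x \<noteq> 0" "x \<noteq> 1" for x
      using that by (intro image_eqI[of _ _ "x - 2"]) auto
    then show ?thesis by fastforce
  qed
  also have "(\<Sum>x\<in>\<dots>. ?f x) = g 0 + g 1 * \<mu> + (\<Sum>x<M. ?f (x + 2))"
    by (subst sum.insert, simp, force, subst sum.insert, simp, force)
       (simp add: sum.reindex del: fact_Suc power_Suc add_2_eq_Suc')
  also have "(\<Sum>x<M. ?f (x + 2)) = g 2 * (\<Sum>x<M. \<mu> ^ (x + 2) / fact (x + 2))"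
  proof -
    have "g (x + 2) = g 2" for x by (rule assms(2)) simp
    then show ?thesis by (simp add: sum_distrib_left)
  qed
  also have "(\<Sum>x<M. \<mu> ^ (x + 2) / fact (x + 2)) \<le> exp \<mu> - 1 - \<mu>"
  proof -
    have s: "(\<lambda>x. \<mu> ^ (x + 2) / fact (x + 2)) sums (exp \<mu> - (\<Sum>x<2. \<mu> ^ x / fact x))"
      by (rule sums_split_initial_segment) (use exp_converges[of \<mu>] in \<open>simp add: scaleR_conv_of_real divide_inverse mult.commute\<close>)
    have "(\<Sum>x<M. \<mu> ^ (x + 2) / fact (x + 2)) \<le> (\<Sum>x. \<mu> ^ (x + 2) / fact (x + 2))"
      using s assms by (intro sum_le_suminf) (auto simp: sums_iff)
    also have "\<dots> = exp \<mu> - 1 - \<mu>" using s by (simp add: sums_iff numeral_2_eq_2)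
    finally show ?thesis .
  qed
  finally show ?thesis using assms(3)[of 2] by (simp add: mult_left_mono)
qed

text \<open>
  Multinomial counts are independent Poisson counts conditioned on their sum being \<open>m\<close>, an event of
  probability at least \<open>1 / (e m)\<close>. For nonnegative functions the conditional expectation is thus at
  most \<open>e m\<close> times the unconditional one. The factors on the right are the Poisson expectations of
  functions that are constant from \<open>2\<close> on.
\<close>
lemma expectation_prod_count_le_poisson:
  fixes g :: "'a \<Rightarrow> nat \<Rightarrow> real"
  assumes S: "finite S" "set_pmf p \<subseteq> S" and m: "m \<ge> 1"
    and g: "\<And>i x. i \<in> S \<Longrightarrow> g i x \<ge> 0" "\<And>i x. i \<in> S \<Longrightarrow> x \<ge> 2 \<Longrightarrow> g i x = g i 2"
    and \<mu>: "\<And>i. \<mu> i = real m * pmf p i"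
  shows "measure_pmf.expectation (replicate_pmf m p) (\<lambda>xs. \<Prod>i\<in>S. g i (count_list xs i))
    \<le> exp 1 * real m *
      (\<Prod>i\<in>S. exp (- \<mu> i) * (g i 0 + g i 1 * \<mu> i + g i 2 * (exp (\<mu> i) - 1 - \<mu> i)))"
proof -
  let ?F = "\<lambda>i. count_gf (pmf p i) (g i)"
  have nn: "fps_nth (?F i) x \<ge> 0" if "i \<in> S" for i x
    using that g by (simp add: count_gf_def)
  have nnP: "\<forall>x. fps_nth (\<Prod>i\<in>S. ?F i) x \<ge> 0"
    and leP: "fps_partial m (real m) (\<Prod>i\<in>S. ?F i) \<le> (\<Prod>i\<in>S. fps_partial m (real m) (?F i))"
    using fps_partial_prod_le[of S ?F "real m" m] S nn by auto
  have "fps_nth (\<Prod>i\<in>S. ?F i) m * real m ^ m \<le> fps_partial m (real m) (\<Prod>i\<in>S. ?F i)"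
    unfolding fps_partial_def by (rule member_le_sum) (use nnP in auto)
  also note leP
  also have "(\<Prod>i\<in>S. fps_partial m (real m) (?F i)) \<le> (\<Prod>i\<in>S. g i 0 + g i 1 * \<mu> i + g i 2 * (exp (\<mu> i) - 1 - \<mu> i))"
  proof (intro prod_mono conjI)
    fix i assume i: "i \<in> S"
    have "fps_partial m (real m) (?F i) = (\<Sum>x\<le>m. g i x * \<mu> i ^ x / fact x)"
      unfolding fps_partial_def count_gf_def by (simp add: \<mu> power_mult_distrib mult_ac)
    also have "\<dots> \<le> g i 0 + g i 1 * \<mu> i + g i 2 * (exp (\<mu> i) - 1 - \<mu> i)"
      by (rule sum_exp_tail_le) (simp add: \<mu>, erule g(2)[OF i], rule g(1)[OF i])
    finally show "fps_partial m (real m) (?F i) \<le> g i 0 + g i 1 * \<mu> i + g i 2 * (exp (\<mu> i) - 1 - \<mu> i)" .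
    show "fps_partial m (real m) (?F i) \<ge> 0"
      unfolding fps_partial_def using nn i by (intro sum_nonneg) auto
  qed
  finally have coeff: "fps_nth (\<Prod>i\<in>S. ?F i) m * real m ^ m
      \<le> (\<Prod>i\<in>S. g i 0 + g i 1 * \<mu> i + g i 2 * (exp (\<mu> i) - 1 - \<mu> i))" (is "_ \<le> ?R") .
  have R: "?R \<ge> 0" by (rule order_trans[OF _ coeff]) (use nnP in auto)
  have tot: "(\<Sum>i\<in>S. \<mu> i) = real m"
    unfolding \<mu> sum_distrib_left[symmetric] using S by (simp add: sum_pmf_eq_1)
  have "fact m * fps_nth (\<Prod>i\<in>S. ?F i) m = (fact m / real m ^ m) * (fps_nth (\<Prod>i\<in>S. ?F i) m * real m ^ m)"
    using m by simp
  also have "\<dots> \<le> (fact m / real m ^ m) * ?R"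
    by (intro mult_left_mono coeff) auto
  also have "\<dots> \<le> (exp 1 * real m * exp (- real m)) * ?R"
  proof (intro mult_right_mono R)
    show "fact m / real m ^ m \<le> exp 1 * real m * exp (- real m)"
      using fact_le_mode[OF m] m by (simp add: exp_minus field_simps)
  qed
  also have "exp (- real m) = (\<Prod>i\<in>S. exp (- \<mu> i))"
    using S by (simp add: tot[symmetric] sum_negf[symmetric] exp_sum)
  finally show ?thesis
    by (simp add: expectation_prod_count_eq_coeff[OF S] prod.distrib mult.assoc)
qed

section \<open>The score of a single bin\<close>
lemma nonneg_of_deriv_nonneg:
  fixes F :: "real \<Rightarrow> real"
  assumes "x \<ge> 0" "F 0 = 0"
    and "\<And>t. t \<ge> 0 \<Longrightarrow> (F has_real_derivative F' t) (at t)" "\<And>t. t \<ge> 0 \<Longrightarrow> F' t \<ge> 0"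
  shows "F x \<ge> 0"
  using DERIV_nonneg_imp_nondecreasing[of 0 x F] assms by fastforce

text \<open>
  Among the functions of a count that depend only on whether it is \<open>0\<close>, \<open>1\<close> or larger, this is, up to
  a factor, the one whose expectation under a Poisson variable of rate \<open>\<mu>\<close>, as a function of \<open>\<mu>\<close>, has
  the value and the derivative \<open>0\<close> at \<open>\<mu> = \<nu>\<close>. That expectation is \<open>score_mean \<nu> \<mu>\<close>.
\<close>
definition score :: "real \<Rightarrow> nat \<Rightarrow> real" where
  "score \<nu> x = exp (- \<nu>) + (if x = 0 then \<nu> - 1 else if x = 1 then - 1 else 0)"

definition score_mean :: "real \<Rightarrow> real \<Rightarrow> real" where
  "score_mean \<nu> \<mu> = exp (- \<nu>) - exp (- \<mu>) * (1 - \<nu> + \<mu>)"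

text \<open>
  The right-hand side is the probability that a Poisson count of rate \<open>\<mu>\<close> is at least \<open>2\<close>.
\<close>
lemma collision_prob_lower:
  fixes \<mu> :: real
  assumes "\<mu> \<ge> 0"
  shows "(1 - exp (- \<mu>))\<^sup>2 / 2 \<le> 1 - exp (- \<mu>) * (1 + \<mu>)"
proof -
  have "0 \<le> 1 - exp (- \<mu>) * (1 + \<mu>) - (1 - exp (- \<mu>))\<^sup>2 / 2"
  proof (rule nonneg_of_deriv_nonneg[OF assms, of "\<lambda>\<mu>. 1 - exp (- \<mu>) * (1 + \<mu>) - (1 - exp (- \<mu>))\<^sup>2 / 2"
        "\<lambda>t. exp (- t) * (t - 1 + exp (- t))"])
    fix t :: real assume "t \<ge> 0"
    show "((\<lambda>\<mu>. 1 - exp (- \<mu>) * (1 + \<mu>) - (1 - exp (- \<mu>))\<^sup>2 / 2) has_real_derivative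
        exp (- t) * (t - 1 + exp (- t))) (at t)"
      by (auto intro!: derivative_eq_intros simp: field_simps power2_eq_square)
    show "0 \<le> exp (- t) * (t - 1 + exp (- t))"
      using exp_ge_add_one_self[of "-t"] by (intro mult_nonneg_nonneg) auto
  qed simp
  then show ?thesis by simp
qed

text \<open>
  The left-hand side bounds the second moment of the score, which has modulus at most \<open>\<nu>\<close> on the
  counts \<open>0\<close> and \<open>1\<close> and at most \<open>1\<close> elsewhere. The point is that the probability of
  a count of at least \<open>2\<close>, which may be close to \<open>1\<close> when \<open>\<mu>\<close> is large, is paid for by the mean.
\<close>
lemma score_second_moment:
  fixes \<nu> \<mu> :: real
  assumes "0 \<le> \<nu>" "\<mu> \<ge> 0"
  shows "exp (- \<mu>) * (\<nu>\<^sup>2 + \<nu>\<^sup>2 * \<mu> + (exp \<mu> - 1 - \<mu>)) \<le> 3 * \<nu>\<^sup>2 + 2 * score_mean \<nu> \<mu>"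
proof -
  define u where "u = 1 - exp (- \<mu>)"
  define P where "P = 1 - exp (- \<mu>) * (1 + \<mu>)"
  have P: "u\<^sup>2 / 2 \<le> P" unfolding u_def P_def by (rule collision_prob_lower[OF assms(2)])
  have "0 \<le> (u / 2 - \<nu>)\<^sup>2" by simp
  then have amgm: "\<nu> * u \<le> u\<^sup>2 / 4 + \<nu>\<^sup>2" by (simp add: power2_eq_square algebra_simps)
  have "score_mean \<nu> \<mu> = P - \<nu> * u + (exp (- \<nu>) - (1 - \<nu>))"
    by (simp add: score_mean_def P_def u_def algebra_simps)
  then have "score_mean \<nu> \<mu> \<ge> P - \<nu> * u"
    using exp_ge_add_one_self[of "-\<nu>"] by simp
  then have P': "P \<le> 2 * score_mean \<nu> \<mu> + 2 * \<nu>\<^sup>2" using amgm P by linarith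
  have "exp (- \<mu>) * (1 + \<mu>) \<le> exp (- \<mu>) * exp \<mu>"
    by (intro mult_left_mono) auto
  then have "\<nu>\<^sup>2 * (exp (- \<mu>) * (1 + \<mu>)) \<le> \<nu>\<^sup>2 * 1"
    by (intro mult_left_mono) (auto simp: exp_minus)
  moreover have "exp (- \<mu>) * (\<nu>\<^sup>2 + \<nu>\<^sup>2 * \<mu> + (exp \<mu> - 1 - \<mu>)) = \<nu>\<^sup>2 * (exp (- \<mu>) * (1 + \<mu>)) + P"
    by (simp add: P_def algebra_simps exp_minus)
  ultimately show ?thesis using P' by linarith
qed

lemma score_mean_shift: "score_mean \<nu> \<mu> = exp (- \<nu>) * (1 - exp (- (\<mu> - \<nu>)) * (1 + (\<mu> - \<nu>)))"
proof -
  have "exp (- \<nu>) * exp (- (\<mu> - \<nu>)) = exp (- \<mu>)" by (simp add: mult_exp_exp)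
  then show ?thesis unfolding score_mean_def right_diff_distrib mult.assoc[symmetric] by simp
qed

lemma score_mean_nonneg: "score_mean \<nu> \<mu> \<ge> 0"
proof -
  have "exp (- (\<mu> - \<nu>)) * (1 + (\<mu> - \<nu>)) \<le> exp (- (\<mu> - \<nu>)) * exp (\<mu> - \<nu>)"
    by (intro mult_left_mono exp_ge_add_one_self) auto
  then show ?thesis unfolding score_mean_shift by (intro mult_nonneg_nonneg) (auto simp: mult_exp_exp)
qed

text \<open>
  The next two bounds say that the mean behaves like the squared deviation. The lower one is
  restricted to \<open>\<mu> \<le> \<nu>\<close>, since for large \<open>\<mu>\<close> the mean stays bounded.
\<close>
lemma score_mean_upper:
  assumes "0 \<le> \<nu>" "\<nu> \<le> 1" "\<mu> \<ge> 0"
  shows "score_mean \<nu> \<mu> \<le> (\<mu> - \<nu>)\<^sup>2"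
proof -
  define d where "d = \<mu> - \<nu>"
  have "(1 - d) * (1 + d) \<le> exp (- d) * (1 + d)"
  proof (rule mult_right_mono)
    show "1 - d \<le> exp (- d)" using exp_ge_add_one_self[of "-d"] by simp
  qed (use assms in \<open>simp add: d_def\<close>)
  then have "1 - exp (- d) * (1 + d) \<le> d\<^sup>2" by (simp add: power2_eq_square algebra_simps)
  then have "score_mean \<nu> \<mu> \<le> exp (- \<nu>) * d\<^sup>2"
    unfolding score_mean_shift d_def[symmetric] by (intro mult_left_mono) auto
  also have "\<dots> \<le> 1 * d\<^sup>2" using assms by (intro mult_right_mono) auto
  finally show ?thesis by (simp add: d_def)
qed

lemma score_mean_lower:
  assumes "\<mu> \<le> \<nu>" "\<nu> \<le> 1"
  shows "(\<nu> - \<mu>)\<^sup>2 / 6 \<le> score_mean \<nu> \<mu>"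
proof -
  define t where "t = \<nu> - \<mu>"
  have t: "t \<ge> 0" using assms by (simp add: t_def)
  have "0 \<le> 1 - t\<^sup>2 / 2 - exp t * (1 - t)"
  proof (rule nonneg_of_deriv_nonneg[OF t, of "\<lambda>t. 1 - t\<^sup>2 / 2 - exp t * (1 - t)" "\<lambda>t. t * (exp t - 1)"])
    fix x :: real assume "x \<ge> 0"
    show "((\<lambda>t. 1 - t\<^sup>2 / 2 - exp t * (1 - t)) has_real_derivative x * (exp x - 1)) (at x)"
      by (auto intro!: derivative_eq_intros simp: algebra_simps)
    show "0 \<le> x * (exp x - 1)" using \<open>x \<ge> 0\<close> by simp
  qed simp
  then have 1: "t\<^sup>2 / 2 \<le> 1 - exp t * (1 - t)" by simp
  have "exp \<nu> \<le> exp 1" using assms by simp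
  also have "\<dots> \<le> (3::real)" by (rule exp_le)
  finally have "1 / 3 \<le> exp (- \<nu>)" by (simp add: exp_minus field_simps)
  then have "(1 / 3) * (t\<^sup>2 / 2) \<le> exp (- \<nu>) * (1 - exp t * (1 - t))"
    by (intro mult_mono 1) auto
  then show ?thesis by (simp add: score_mean_shift t_def algebra_simps)
qed

lemma exp_le_quadratic:
  fixes y :: real
  assumes "\<bar>y\<bar> \<le> 1"
  shows "exp y \<le> 1 + y + y\<^sup>2"
proof (cases "y \<ge> 0")
  case True
  then show ?thesis using exp_bound[of y] assms by simp
next
  case False
  have "0 \<le> 1 - (-y) + (-y)\<^sup>2 / 2 - exp (- (-y))"
  proof (rule nonneg_of_deriv_nonneg[of "-y" "\<lambda>t. 1 - t + t\<^sup>2 / 2 - exp (- t)" "\<lambda>t. - 1 + t + exp (- t)"])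
    fix x :: real assume "x \<ge> 0"
    show "((\<lambda>t. 1 - t + t\<^sup>2 / 2 - exp (- t)) has_real_derivative - 1 + x + exp (- x)) (at x)"
      by (auto intro!: derivative_eq_intros simp: algebra_simps)
    show "0 \<le> - 1 + x + exp (- x)" using exp_ge_add_one_self[of "-x"] by linarith
  qed (use False in auto)
  then have "exp y \<le> 1 + y + y\<^sup>2 / 2" by simp
  then show ?thesis using zero_le_power2[of y] by linarith
qed

text \<open>
  The exponential moment of the score under a Poisson count, from \<open>exp y \<le> 1 + y + y\<^sup>2\<close> and the bound
  on the second moment. The sign of \<open>s\<close> is free, so that both tails are covered.
\<close>
lemma score_mgf_le:
  fixes s \<nu> \<mu> :: real
  assumes "0 \<le> \<nu>" "\<nu> \<le> 1" "\<mu> \<ge> 0" "\<bar>s\<bar> \<le> 1"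
  shows "exp (- \<mu>) * (exp (s * score \<nu> 0) + exp (s * score \<nu> 1) * \<mu> + exp (s * score \<nu> 2) * (exp \<mu> - 1 - \<mu>))
    \<le> exp (s * score_mean \<nu> \<mu> + s\<^sup>2 * (3 * \<nu>\<^sup>2 + 2 * score_mean \<nu> \<mu>))"
proof -
  have el: "exp (- \<nu>) \<ge> 1 - \<nu>" "exp (- \<nu>) \<le> 1"
    using exp_ge_add_one_self[of "-\<nu>"] assms by auto
  have bound: "exp (s * z) \<le> 1 + s * z + s\<^sup>2 * b\<^sup>2" if "\<bar>z\<bar> \<le> b" "b \<le> 1" for z b
  proof -
    have "\<bar>s * z\<bar> \<le> 1 * 1" unfolding abs_mult using assms that by (intro mult_mono) auto
    then have "exp (s * z) \<le> 1 + s * z + (s * z)\<^sup>2" by (intro exp_le_quadratic) simp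
    also have "z\<^sup>2 \<le> b\<^sup>2" using that by (simp add: abs_le_square_iff[symmetric])
    then have "(s * z)\<^sup>2 \<le> s\<^sup>2 * b\<^sup>2" by (simp add: power_mult_distrib mult_left_mono)
    finally show ?thesis by simp
  qed
  have b0: "exp (s * score \<nu> 0) \<le> 1 + s * score \<nu> 0 + s\<^sup>2 * \<nu>\<^sup>2"
    using el assms by (intro bound) (auto simp: score_def)
  have b1: "exp (s * score \<nu> 1) \<le> 1 + s * score \<nu> 1 + s\<^sup>2 * \<nu>\<^sup>2"
    using el assms by (intro bound) (auto simp: score_def)
  have b2: "exp (s * score \<nu> 2) \<le> 1 + s * score \<nu> 2 + s\<^sup>2 * 1\<^sup>2"
    using el assms by (intro bound) (auto simp: score_def)
  have tail: "exp \<mu> - 1 - \<mu> \<ge> 0" using exp_ge_add_one_self[of \<mu>] by linarith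
  have "exp (- \<mu>) * (exp (s * score \<nu> 0) + exp (s * score \<nu> 1) * \<mu> + exp (s * score \<nu> 2) * (exp \<mu> - 1 - \<mu>))
    \<le> exp (- \<mu>) * ((1 + s * score \<nu> 0 + s\<^sup>2 * \<nu>\<^sup>2) + (1 + s * score \<nu> 1 + s\<^sup>2 * \<nu>\<^sup>2) * \<mu>
        + (1 + s * score \<nu> 2 + s\<^sup>2 * 1\<^sup>2) * (exp \<mu> - 1 - \<mu>))"
    using assms tail by (intro mult_left_mono add_mono mult_right_mono b0 b1 b2) auto
  also have "\<dots> = 1 + s * score_mean \<nu> \<mu> + s\<^sup>2 * (exp (- \<mu>) * (\<nu>\<^sup>2 + \<nu>\<^sup>2 * \<mu> + (exp \<mu> - 1 - \<mu>)))"
  proof -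
    have e: "exp (- \<mu>) * exp \<mu> = 1" by (simp add: mult_exp_exp)
    have "exp (- \<mu>) * ((1 + s * score \<nu> 0 + s\<^sup>2 * \<nu>\<^sup>2) + (1 + s * score \<nu> 1 + s\<^sup>2 * \<nu>\<^sup>2) * \<mu>
          + (1 + s * score \<nu> 2 + s\<^sup>2 * 1\<^sup>2) * (exp \<mu> - 1 - \<mu>))
        = 1 + s * score_mean \<nu> \<mu> + s\<^sup>2 * (exp (- \<mu>) * (\<nu>\<^sup>2 + \<nu>\<^sup>2 * \<mu> + (exp \<mu> - 1 - \<mu>)))
          + (exp (- \<mu>) * exp \<mu> - 1) * (1 + s * exp (- \<nu>))"
      unfolding score_def score_mean_def by (simp only: algebra_simps) (simp add: algebra_simps)
    then show ?thesis using e by simp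
  qed
  also have "\<dots> \<le> 1 + s * score_mean \<nu> \<mu> + s\<^sup>2 * (3 * \<nu>\<^sup>2 + 2 * score_mean \<nu> \<mu>)"
    using assms by (intro add_left_mono mult_left_mono score_second_moment) auto
  also have "\<dots> \<le> exp (s * score_mean \<nu> \<mu> + s\<^sup>2 * (3 * \<nu>\<^sup>2 + 2 * score_mean \<nu> \<mu>))"
    using exp_ge_add_one_self[of "s * score_mean \<nu> \<mu> + s\<^sup>2 * (3 * \<nu>\<^sup>2 + 2 * score_mean \<nu> \<mu>)"] by (simp add: add_ac)
  finally show ?thesis .
qed

definition total_score :: "'a set \<Rightarrow> ('a \<Rightarrow> real) \<Rightarrow> 'a list \<Rightarrow> real" where
  "total_score S \<nu> ys = (\<Sum>b\<in>S. score (\<nu> b) (count_list ys b))"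

lemma total_score_mgf_le:
  fixes p :: "'a pmf" and s :: real
  assumes S: "finite S" "set_pmf p \<subseteq> S" and m: "m \<ge> 1"
    and l: "\<And>b. b \<in> S \<Longrightarrow> 0 \<le> \<nu> b \<and> \<nu> b \<le> 1" and s: "\<bar>s\<bar> \<le> 1"
  shows "measure_pmf.expectation (replicate_pmf m p) (\<lambda>ys. exp (s * total_score S \<nu> ys))
    \<le> exp 1 * real m * exp ((s + 2 * s\<^sup>2) * (\<Sum>b\<in>S. score_mean (\<nu> b) (m * pmf p b)) + 3 * s\<^sup>2 * (\<Sum>b\<in>S. (\<nu> b)\<^sup>2))"
proof -
  let ?\<mu> = "\<lambda>b. real m * pmf p b"
  let ?g = "\<lambda>b x. exp (s * score (\<nu> b) x)"
  have "measure_pmf.expectation (replicate_pmf m p) (\<lambda>ys. exp (s * total_score S \<nu> ys))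
      = measure_pmf.expectation (replicate_pmf m p) (\<lambda>ys. \<Prod>b\<in>S. ?g b (count_list ys b))"
    using S by (simp add: total_score_def sum_distrib_left exp_sum)
  also have "\<dots> \<le> exp 1 * real m *
      (\<Prod>b\<in>S. exp (- ?\<mu> b) * (?g b 0 + ?g b 1 * ?\<mu> b + ?g b 2 * (exp (?\<mu> b) - 1 - ?\<mu> b)))"
    by (rule expectation_prod_count_le_poisson[OF S m]) (auto simp: score_def)
  also have "\<dots> \<le> exp 1 * real m *
      (\<Prod>b\<in>S. exp (s * score_mean (\<nu> b) (?\<mu> b) + s\<^sup>2 * (3 * (\<nu> b)\<^sup>2 + 2 * score_mean (\<nu> b) (?\<mu> b))))"
  proof (intro mult_left_mono prod_mono conjI)
    fix b assume b: "b \<in> S"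
    have "exp (?\<mu> b) - 1 - ?\<mu> b \<ge> 0" using exp_ge_add_one_self[of "?\<mu> b"] by linarith
    then show "0 \<le> exp (- ?\<mu> b) * (?g b 0 + ?g b 1 * ?\<mu> b + ?g b 2 * (exp (?\<mu> b) - 1 - ?\<mu> b))"
      by (intro mult_nonneg_nonneg add_nonneg_nonneg) auto
    show "exp (- ?\<mu> b) * (?g b 0 + ?g b 1 * ?\<mu> b + ?g b 2 * (exp (?\<mu> b) - 1 - ?\<mu> b))
        \<le> exp (s * score_mean (\<nu> b) (?\<mu> b) + s\<^sup>2 * (3 * (\<nu> b)\<^sup>2 + 2 * score_mean (\<nu> b) (?\<mu> b)))"
      using l[OF b] s by (intro score_mgf_le) auto
  qed auto
  also have "\<dots> = exp 1 * real m * exp ((s + 2 * s\<^sup>2) * (\<Sum>b\<in>S. score_mean (\<nu> b) (m * pmf p b)) + 3 * s\<^sup>2 * (\<Sum>b\<in>S. (\<nu> b)\<^sup>2))"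
    using S by (simp add: exp_sum[symmetric] sum.distrib sum_distrib_left distrib_right distrib_left mult.assoc mult.left_commute)
  finally show ?thesis .
qed

lemma prob_le_exp_moment:
  fixes p :: "'a pmf" and f :: "'a \<Rightarrow> real"
  assumes "finite (set_pmf p)" "\<And>x. x \<in> A \<Longrightarrow> 0 \<le> f x"
  shows "measure_pmf.prob p A \<le> measure_pmf.expectation p (\<lambda>x. exp (f x))"
proof -
  have "measure_pmf.prob p A = measure_pmf.expectation p (indicator A)" by simp
  also have "\<dots> \<le> measure_pmf.expectation p (\<lambda>x. exp (f x))"
    using assms by (intro integral_mono integrable_measure_pmf_finite) (auto simp: indicator_def)
  finally show ?thesis .
qed

section \<open>Testing identity to a known distribution\<close>
lemma expectation_bind_finite:
  fixes f :: "'b \<Rightarrow> real"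
  assumes "finite (set_pmf p)" "\<And>x. finite (set_pmf (K x))"
  shows "measure_pmf.expectation (bind_pmf p K) f = measure_pmf.expectation p (\<lambda>x. measure_pmf.expectation (K x) f)"
  using assms by (simp add: pmf_expectation_bind[of "set_pmf p"] integral_measure_pmf[of "set_pmf p" p])

primrec relabel :: "('a \<Rightarrow> 'b pmf) \<Rightarrow> 'a list \<Rightarrow> 'b list pmf" where
  "relabel K [] = return_pmf []"
| "relabel K (x # xs) = bind_pmf (K x) (\<lambda>y. map_pmf ((#) y) (relabel K xs))"

lemma finite_set_relabel:
  assumes "\<And>x. finite (set_pmf (K x))"
  shows "finite (set_pmf (relabel K xs))"
  by (induction xs) (auto simp: assms)

lemma replicate_bind_pmf:
  "replicate_pmf m (bind_pmf p K) = bind_pmf (replicate_pmf m p) (relabel K)"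
proof (induction m)
  case (Suc m)
  have "replicate_pmf (Suc m) (bind_pmf p K)
      = bind_pmf p (\<lambda>x. bind_pmf (K x) (\<lambda>y. bind_pmf (replicate_pmf m p) (\<lambda>xs. map_pmf ((#) y) (relabel K xs))))"
    by (simp add: Suc bind_assoc_pmf map_pmf_def)
  also have "\<dots> = bind_pmf p (\<lambda>x. bind_pmf (replicate_pmf m p) (\<lambda>xs. bind_pmf (K x) (\<lambda>y. map_pmf ((#) y) (relabel K xs))))"
    by (subst bind_commute_pmf) (rule refl)
  also have "\<dots> = bind_pmf (replicate_pmf (Suc m) p) (relabel K)"
    by (simp add: bind_assoc_pmf bind_return_pmf)
  finally show ?case .
qed (simp add: bind_return_pmf)

text \<open>
  Splitting symbol \<open>i\<close> into \<open>bin_count h B i\<close> equally likely bins leaves every bin with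
  \<open>h\<close>-probability at most \<open>1/B\<close>, while the number of bins is at most \<open>B + n\<close>;
  the extra bin makes up for rounding down. The splitting preserves \<open>\<ell>\<^sub>1\<close> distances.
\<close>
definition bin_count :: "nat pmf \<Rightarrow> real \<Rightarrow> nat \<Rightarrow> nat" where
  "bin_count h B i = nat \<lfloor>B * pmf h i\<rfloor> + 1"

definition bins :: "nat pmf \<Rightarrow> real \<Rightarrow> nat \<Rightarrow> (nat \<times> nat) set" where
  "bins h B n = (SIGMA i:{1..n}. {..<bin_count h B i})"

definition bin_kernel :: "nat pmf \<Rightarrow> real \<Rightarrow> nat \<Rightarrow> (nat \<times> nat) pmf" where
  "bin_kernel h B i = map_pmf (Pair i) (pmf_of_set {..<bin_count h B i})"

definition bin_rate :: "nat \<Rightarrow> nat pmf \<Rightarrow> real \<Rightarrow> nat \<times> nat \<Rightarrow> real" where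
  "bin_rate m h B b = m * pmf h (fst b) / bin_count h B (fst b)"

lemma bin_count_pos: "bin_count h B i > 0" by (simp add: bin_count_def)

lemma finite_bins: "finite (bins h B n)" by (simp add: bins_def)

lemma set_bin_kernel: "set_pmf (bin_kernel h B i) = {i} \<times> {..<bin_count h B i}"
proof -
  have "{..<bin_count h B i} \<noteq> {}" using bin_count_pos[of h B i] by auto
  then show ?thesis by (auto simp: bin_kernel_def)
qed

lemma pmf_bind_bin_kernel:
  assumes "dist_on n p" "b \<in> bins h B n"
  shows "pmf (bind_pmf p (bin_kernel h B)) b = pmf p (fst b) / bin_count h B (fst b)"
proof -
  obtain i j where b: "b = (i, j)" "i \<in> {1..n}" "j < bin_count h B i" using assms(2) by (auto simp: bins_def)
  have ne: "{..<bin_count h B i'} \<noteq> {}" for i' using bin_count_pos[of h B i'] by auto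
  have k: "pmf (bin_kernel h B i') b = (if i' = i then 1 / bin_count h B i else 0)" for i'
  proof (cases "i' = i")
    case True
    have "pmf (bin_kernel h B i) (Pair i j) = pmf (pmf_of_set {..<bin_count h B i}) j"
      unfolding bin_kernel_def by (rule pmf_map_inj') (auto simp: inj_on_def)
    then show ?thesis using True b ne by simp
  next
    case False
    then show ?thesis using b set_bin_kernel[of h B i'] by (auto simp: pmf_eq_0_set_pmf)
  qed
  have "pmf (bind_pmf p (bin_kernel h B)) b = (\<Sum>i'\<in>{1..n}. pmf (bin_kernel h B i') b * pmf p i')"
    unfolding pmf_bind using assms(1) by (intro integral_measure_pmf_real) (auto simp: dist_on_def)
  also have "\<dots> = (\<Sum>i'\<in>{1..n}. if i' = i then pmf p i / bin_count h B i else 0)"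
    by (intro sum.cong) (auto simp: k)
  also have "\<dots> = pmf p i / bin_count h B i" using b(2) by simp
  finally show ?thesis using b by simp
qed

lemma sum_bins:
  "(\<Sum>b\<in>bins h B n. f (fst b) / real (bin_count h B (fst b))) = (\<Sum>i\<in>{1..n}. f i)"
proof -
  have "(\<Sum>b\<in>bins h B n. f (fst b) / real (bin_count h B (fst b)))
      = (\<Sum>i\<in>{1..n}. \<Sum>j<bin_count h B i. f i / real (bin_count h B i))"
    unfolding bins_def by (subst sum.Sigma) (auto simp: case_prod_beta)
  also have "\<dots> = (\<Sum>i\<in>{1..n}. f i)"
    using bin_count_pos by (intro sum.cong) auto
  finally show ?thesis .
qed

lemma sum_pmf_dist_on: "dist_on n p \<Longrightarrow> (\<Sum>i\<in>{1..n}. pmf p i) = 1"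
  by (simp add: dist_on_def sum_pmf_eq_1)

lemma card_bins_le:
  assumes "dist_on n h" "B \<ge> 0"
  shows "real (card (bins h B n)) \<le> B + n"
proof -
  have "real (card (bins h B n)) = (\<Sum>i\<in>{1..n}. real (bin_count h B i))"
    by (simp add: bins_def)
  also have "\<dots> \<le> (\<Sum>i\<in>{1..n}. B * pmf h i + 1)"
  proof (intro sum_mono)
    fix i
    have "\<lfloor>B * pmf h i\<rfloor> \<ge> 0" using assms by simp
    then show "real (bin_count h B i) \<le> B * pmf h i + 1"
      unfolding bin_count_def using of_int_floor_le[of "B * pmf h i"] by simp
  qed
  also have "\<dots> = B + n"
    using sum_pmf_dist_on[OF assms(1)] by (simp add: sum.distrib sum_distrib_left[symmetric])
  finally show ?thesis .
qed

lemma bin_rate_bounds: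
  assumes "B > 0" "real m \<le> B"
  shows "0 \<le> bin_rate m h B b" "bin_rate m h B b \<le> m / B" "bin_rate m h B b \<le> 1"
proof -
  have nn: "B * pmf h (fst b) \<ge> 0" using assms by simp
  have "B * pmf h (fst b) \<le> bin_count h B (fst b)"
    unfolding bin_count_def using nn by linarith
  then have "pmf h (fst b) / bin_count h B (fst b) \<le> 1 / B"
    using assms bin_count_pos[of h B "fst b"] by (simp add: field_simps)
  then have "real m * (pmf h (fst b) / bin_count h B (fst b)) \<le> real m * (1 / B)"
    by (intro mult_left_mono) auto
  then show 1: "bin_rate m h B b \<le> m / B" by (simp add: bin_rate_def)
  show "0 \<le> bin_rate m h B b" by (simp add: bin_rate_def)
  have "m / B \<le> 1" using assms by (simp add: field_simps)
  then show "bin_rate m h B b \<le> 1" using 1 by linarith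
qed

lemma sum_bin_rate_squared_le:
  assumes "dist_on n h" "B > 0" "real m \<le> B"
  shows "(\<Sum>b\<in>bins h B n. (bin_rate m h B b)\<^sup>2) \<le> (real m)\<^sup>2 / B"
proof -
  have "(\<Sum>b\<in>bins h B n. (bin_rate m h B b)\<^sup>2) \<le> (\<Sum>b\<in>bins h B n. m / B * bin_rate m h B b)"
    unfolding power2_eq_square using bin_rate_bounds[OF assms(2,3)] by (intro sum_mono mult_right_mono) auto
  also have "\<dots> = m / B * (\<Sum>i\<in>{1..n}. m * pmf h i)"
    unfolding sum_bins[symmetric, of _ n h B] by (simp add: bin_rate_def sum_distrib_left)
  also have "\<dots> = (real m)\<^sup>2 / B"
    using sum_pmf_dist_on[OF assms(1)] by (simp add: sum_distrib_left[symmetric] power2_eq_square)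
  finally show ?thesis .
qed

text \<open>
  The probability, over the random splitting of the given samples, that the test for \<open>h\<close> accepts.
  Keeping this number instead of a random verdict lets the tests for different \<open>h\<close> be combined
  without choosing a joint distribution of their internal randomness.
\<close>
definition accept_score :: "nat \<Rightarrow> nat \<Rightarrow> real \<Rightarrow> real \<Rightarrow> nat pmf \<Rightarrow> nat list \<Rightarrow> real" where
  "accept_score n m B T h xs = measure_pmf.prob (relabel (bin_kernel h B) xs)
     {ys. total_score (bins h B n) (bin_rate m h B) ys \<le> T}"

lemma expectation_accept_score:
  assumes "dist_on n p"
  shows "measure_pmf.expectation (replicate_pmf m p) (accept_score n m B T h)
    = measure_pmf.prob (replicate_pmf m (bind_pmf p (bin_kernel h B)))
        {ys. total_score (bins h B n) (bin_rate m h B) ys \<le> T}"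
proof -
  let ?A = "{ys. total_score (bins h B n) (bin_rate m h B) ys \<le> T}"
  have fin: "finite (set_pmf p)" using assms finite_subset[of "set_pmf p" "{1..n}"] by (simp add: dist_on_def)
  have "measure_pmf.prob (replicate_pmf m (bind_pmf p (bin_kernel h B))) ?A
    = measure_pmf.expectation (bind_pmf (replicate_pmf m p) (relabel (bin_kernel h B))) (indicator ?A)"
    by (simp add: replicate_bind_pmf)
  also have "\<dots> = measure_pmf.expectation (replicate_pmf m p) (\<lambda>xs. measure_pmf.expectation (relabel (bin_kernel h B) xs) (indicator ?A))"
    by (intro expectation_bind_finite finite_set_replicate_pmf fin finite_set_relabel) (simp add: set_bin_kernel)
  finally show ?thesis by (simp add: accept_score_def[abs_def])
qed

text \<open>
  Members of the class are only near a member of the cover, so the score must be small at rates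
  that deviate slightly from the hypothesis, too.
\<close>
lemma sum_score_mean_close:
  assumes "finite S" "\<And>b. b \<in> S \<Longrightarrow> 0 \<le> \<nu> b \<and> \<nu> b \<le> 1 \<and> 0 \<le> \<mu> b"
    and "(\<Sum>b\<in>S. \<bar>\<mu> b - \<nu> b\<bar>) \<le> 1"
  shows "(\<Sum>b\<in>S. score_mean (\<nu> b) (\<mu> b)) \<le> 1"
proof -
  have "(\<Sum>b\<in>S. score_mean (\<nu> b) (\<mu> b)) \<le> (\<Sum>b\<in>S. \<bar>\<mu> b - \<nu> b\<bar>)"
  proof (intro sum_mono)
    fix b assume b: "b \<in> S"
    have "\<bar>\<mu> b - \<nu> b\<bar> \<le> 1"
      using member_le_sum[OF b, of "\<lambda>b. \<bar>\<mu> b - \<nu> b\<bar>"] assms by simp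
    then have "\<bar>\<mu> b - \<nu> b\<bar> * \<bar>\<mu> b - \<nu> b\<bar> \<le> 1 * \<bar>\<mu> b - \<nu> b\<bar>" by (intro mult_right_mono) auto
    then have "(\<mu> b - \<nu> b)\<^sup>2 \<le> \<bar>\<mu> b - \<nu> b\<bar>" by (simp add: power2_eq_square)
    moreover have "score_mean (\<nu> b) (\<mu> b) \<le> (\<mu> b - \<nu> b)\<^sup>2"
      using assms(2)[OF b] by (intro score_mean_upper) auto
    ultimately show "score_mean (\<nu> b) (\<mu> b) \<le> \<bar>\<mu> b - \<nu> b\<bar>" by linarith
  qed
  then show ?thesis using assms by linarith
qed

text \<open>
  The deviations \<open>\<mu> b - \<nu> b\<close> sum to \<open>0\<close>, so the bins with \<open>\<mu> b \<le> \<nu> b\<close> carry half of the \<open>\<ell>\<^sub>1\<close> distance,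
  and Cauchy-Schwarz turns this into a lower bound for the sum of the squared deviations on them.
\<close>
lemma sum_score_mean_far:
  assumes "finite S" "\<And>b. b \<in> S \<Longrightarrow> \<nu> b \<le> 1"
    and eq: "(\<Sum>b\<in>S. \<mu> b) = (\<Sum>b\<in>S. \<nu> b)"
    and far: "(\<Sum>b\<in>S. \<bar>\<mu> b - \<nu> b\<bar>) \<ge> D" and D: "D \<ge> 0" and N: "real (card S) \<le> N" "N > 0"
  shows "(\<Sum>b\<in>S. score_mean (\<nu> b) (\<mu> b)) \<ge> D\<^sup>2 / (24 * N)"
proof -
  define Neg where "Neg = {b\<in>S. \<mu> b \<le> \<nu> b}"
  have fin: "finite Neg" "Neg \<subseteq> S" using assms by (auto simp: Neg_def)
  have "(\<Sum>b\<in>S. \<bar>\<mu> b - \<nu> b\<bar>) = (\<Sum>b\<in>S. (\<mu> b - \<nu> b) + (if b \<in> Neg then 2 * (\<nu> b - \<mu> b) else 0))"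
    by (intro sum.cong) (auto simp: Neg_def)
  also have "\<dots> = (\<Sum>b\<in>Neg. 2 * (\<nu> b - \<mu> b))"
    using eq assms(1) fin by (simp add: sum.distrib sum_subtractf sum.inter_restrict[symmetric] Int_absorb1)
  also have "\<dots> = 2 * (\<Sum>b\<in>Neg. \<nu> b - \<mu> b)" by (rule sum_distrib_left[symmetric])
  finally have half: "(\<Sum>b\<in>Neg. \<nu> b - \<mu> b) \<ge> D / 2"
    using far by simp
  then have "(D / 2)\<^sup>2 \<le> (\<Sum>b\<in>Neg. \<nu> b - \<mu> b)\<^sup>2" using D by (intro power_mono) auto
  also have "\<dots> \<le> (\<Sum>b\<in>Neg. (\<nu> b - \<mu> b)\<^sup>2) * card Neg"
    by (rule sum_squared_le_sum_of_squares) 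
  also have "\<dots> \<le> (\<Sum>b\<in>Neg. (\<nu> b - \<mu> b)\<^sup>2) * N"
    using N card_mono[OF assms(1) fin(2)] by (intro mult_left_mono sum_nonneg) auto
  finally have "D\<^sup>2 / (4 * N) \<le> (\<Sum>b\<in>Neg. (\<nu> b - \<mu> b)\<^sup>2)" using N by (simp add: field_simps power2_eq_square)
  then have "D\<^sup>2 / (24 * N) \<le> (\<Sum>b\<in>Neg. (\<nu> b - \<mu> b)\<^sup>2 / 6)"
    by (simp add: sum_divide_distrib[symmetric])
  also have "\<dots> \<le> (\<Sum>b\<in>Neg. score_mean (\<nu> b) (\<mu> b))"
    using assms(2) by (intro sum_mono score_mean_lower) (auto simp: Neg_def)
  also have "\<dots> \<le> (\<Sum>b\<in>S. score_mean (\<nu> b) (\<mu> b))"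
    using assms(1) fin by (intro sum_mono2) (auto simp: score_mean_nonneg)
  finally show ?thesis .
qed

text \<open>
  Chernoff's method with parameter \<open>s = \<epsilon>\<^sup>2 / 1152\<close>, in the direction \<open>+s\<close> for a near \<open>p\<close> and \<open>-s\<close>
  for a far one. With \<open>Q = m\<^sup>2 / B\<close>, the expected total score of a far \<open>p\<close> is at least
  \<open>m\<^sup>2 \<epsilon>\<^sup>2 / (48 B) = 24 s Q\<close>, the threshold \<open>T\<close> is half of it, and the variance proxy is \<open>3 Q\<close>. So
  \<open>s\<close> makes the linear gain of order \<open>s\<^sup>2 Q\<close> exceed the quadratic loss \<open>3 s\<^sup>2 Q\<close>, leaving at least
  \<open>3 s\<^sup>2 Q\<close> in the exponent on both sides; \<open>442368 = 1152\<^sup>2 / 3\<close>.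
\<close>
lemma accept_score_errors:
  fixes \<epsilon> :: real
  assumes h: "dist_on n h" and p: "dist_on n p" and m: "m \<ge> 1"
    and B: "real m \<le> B" "real n \<le> B" and eps: "0 < \<epsilon>" "\<epsilon> \<le> 2"
    and T: "T = (real m * \<epsilon>)\<^sup>2 / (96 * B)"
    and err: "err = exp 2 * real m * exp (- ((real m * \<epsilon>\<^sup>2)\<^sup>2 / (442368 * B)))"
  shows "real m * l1_norm n (\<lambda>i. pmf p i - pmf h i) \<le> 1 \<Longrightarrow>
      measure_pmf.expectation (replicate_pmf m p) (accept_score n m B T h) \<ge> 1 - err" (is "?close \<Longrightarrow> _")
    and "l1_norm n (\<lambda>i. pmf p i - pmf h i) \<ge> \<epsilon> \<Longrightarrow>
      measure_pmf.expectation (replicate_pmf m p) (accept_score n m B T h) \<le> err" (is "?far \<Longrightarrow> _")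
proof -
  define S where "S = bins h B n"
  define \<nu> where "\<nu> = bin_rate m h B"
  define p' where "p' = bind_pmf p (bin_kernel h B)"
  define P where "P = replicate_pmf m p'"
  define s where "s = \<epsilon>\<^sup>2 / 1152"
  define Q where "Q = (real m)\<^sup>2 / B"
  define M where "M = (\<Sum>b\<in>S. score_mean (\<nu> b) (real m * pmf p' b))"
  have Bpos: "B > 0" using B m by linarith
  have "\<epsilon>\<^sup>2 \<le> 2\<^sup>2" using eps by (intro power_mono) auto
  then have s: "0 < s" "s \<le> 1 / 288" using eps by (auto simp: s_def)
  have finS: "finite S" by (simp add: S_def finite_bins)
  have setp': "set_pmf p' \<subseteq> S"
    using p by (auto simp: p'_def S_def bins_def set_bin_kernel dist_on_def)
  have finP: "finite (set_pmf P)"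
    unfolding P_def by (intro finite_set_replicate_pmf) (use setp' finS finite_subset in blast)
  have \<nu>: "0 \<le> \<nu> b" "\<nu> b \<le> 1" for b
    using bin_rate_bounds[OF Bpos B(1)] by (auto simp: \<nu>_def)
  have pp: "real m * pmf p' b - \<nu> b = (real m * (pmf p (fst b) - pmf h (fst b))) / bin_count h B (fst b)" if "b \<in> S" for b
    using pmf_bind_bin_kernel[OF p] that
    by (simp add: p'_def \<nu>_def bin_rate_def S_def diff_divide_distrib right_diff_distrib)
  have l1: "(\<Sum>b\<in>S. \<bar>real m * pmf p' b - \<nu> b\<bar>) = real m * l1_norm n (\<lambda>i. pmf p i - pmf h i)"
  proof -
    have "(\<Sum>b\<in>S. \<bar>real m * pmf p' b - \<nu> b\<bar>) = (\<Sum>b\<in>S. (real m * \<bar>pmf p (fst b) - pmf h (fst b)\<bar>) / bin_count h B (fst b))"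
      by (intro sum.cong) (auto simp: pp abs_mult)
    also have "\<dots> = (\<Sum>i\<in>{1..n}. real m * \<bar>pmf p i - pmf h i\<bar>)" unfolding S_def by (rule sum_bins)
    finally show ?thesis by (simp add: l1_norm_def sum_distrib_left)
  qed
  have sq: "(\<Sum>b\<in>S. (\<nu> b)\<^sup>2) \<le> Q"
    unfolding S_def \<nu>_def Q_def by (rule sum_bin_rate_squared_le[OF h Bpos B(1)])
  have mgf: "measure_pmf.expectation P (\<lambda>ys. exp (t * total_score S \<nu> ys))
      \<le> exp 1 * real m * exp ((t + 2 * t\<^sup>2) * M + 3 * t\<^sup>2 * Q)" if "\<bar>t\<bar> \<le> 1" for t
  proof -
    have "measure_pmf.expectation P (\<lambda>ys. exp (t * total_score S \<nu> ys))
      \<le> exp 1 * real m * exp ((t + 2 * t\<^sup>2) * M + 3 * t\<^sup>2 * (\<Sum>b\<in>S. (\<nu> b)\<^sup>2))"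
      unfolding P_def M_def by (rule total_score_mgf_le[OF finS setp' m]) (use \<nu> that in auto)
    also have "\<dots> \<le> exp 1 * real m * exp ((t + 2 * t\<^sup>2) * M + 3 * t\<^sup>2 * Q)"
      using sq by (simp add: mult_left_mono)
    finally show ?thesis .
  qed
  have chernoff: "measure_pmf.prob P A \<le> exp 1 * real m * exp ((t + 2 * t\<^sup>2) * M + 3 * t\<^sup>2 * Q - t * T)"
    if A: "\<And>ys. ys \<in> A \<Longrightarrow> 0 \<le> t * (total_score S \<nu> ys - T)" and t: "\<bar>t\<bar> \<le> 1" for A t
  proof -
    have "measure_pmf.prob P A \<le> measure_pmf.expectation P (\<lambda>ys. exp (t * (total_score S \<nu> ys - T)))"
      by (rule prob_le_exp_moment[OF finP A])
    also have "\<dots> = measure_pmf.expectation P (\<lambda>ys. exp (t * total_score S \<nu> ys)) * exp (- (t * T))"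
      by (simp add: right_diff_distrib exp_diff exp_minus divide_inverse)
    also have "\<dots> \<le> exp 1 * real m * exp ((t + 2 * t\<^sup>2) * M + 3 * t\<^sup>2 * Q) * exp (- (t * T))"
      by (intro mult_right_mono mgf t) auto
    also have "\<dots> = exp 1 * real m * exp ((t + 2 * t\<^sup>2) * M + 3 * t\<^sup>2 * Q - t * T)"
      by (simp add: exp_diff exp_minus divide_inverse mult.assoc)
    finally show ?thesis .
  qed
  \<comment> \<open>In units of \<open>s\<close> and \<open>Q\<close>, all exponents below become multiples of \<open>s\<^sup>2 * Q\<close>.\<close>
  have TQ: "T = 12 * s * Q" by (simp add: T s_def Q_def power_mult_distrib)
  have errQ: "err = exp 2 * real m * exp (- (3 * s\<^sup>2 * Q))"
    by (simp add: err s_def Q_def power_mult_distrib power_divide)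
  have errI: "exp 1 * real m * exp x \<le> err" if "x \<le> 1 - 3 * s\<^sup>2 * Q" for x
  proof -
    have "exp 1 * exp x \<le> exp 2 * exp (- (3 * s\<^sup>2 * Q))" using that by (simp add: mult_exp_exp)
    then have "real m * (exp 1 * exp x) \<le> real m * (exp 2 * exp (- (3 * s\<^sup>2 * Q)))" by (intro mult_left_mono) auto
    then show ?thesis by (simp add: errQ mult_ac)
  qed
  have Q0: "Q \<ge> 0" using Bpos by (simp add: Q_def)
  \<comment> \<open>This is where \<open>\<epsilon> \<le> 2\<close> is used: the mean-dependent part of the second moment costs at most a quarter of the linear gain.\<close>
  have s2: "2 * s\<^sup>2 \<le> s / 4"
  proof -
    have "s * s \<le> (1/288) * s" using s by (intro mult_right_mono) auto
    then show ?thesis using s by (simp add: power2_eq_square)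
  qed
  have ex: "measure_pmf.expectation (replicate_pmf m p) (accept_score n m B T h) = measure_pmf.prob P {ys. total_score S \<nu> ys \<le> T}"
    unfolding expectation_accept_score[OF p] P_def p'_def S_def \<nu>_def ..
  {
    assume ?close
    then have M1: "M \<le> 1"
      unfolding M_def using \<nu> l1 by (intro sum_score_mean_close[OF finS]) auto
    have "measure_pmf.prob P {ys. \<not> total_score S \<nu> ys \<le> T} \<le> exp 1 * real m * exp ((s + 2 * s\<^sup>2) * M + 3 * s\<^sup>2 * Q - s * T)"
      using s by (intro chernoff) auto
    also have "\<dots> \<le> err"
    proof (rule errI)
      have "(s + 2 * s\<^sup>2) * M \<le> (s + 2 * s\<^sup>2) * 1" using s M1 by (intro mult_left_mono) auto
      also have "\<dots> \<le> 1" using s s2 by simp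
      finally have "(s + 2 * s\<^sup>2) * M \<le> 1" .
      moreover have "s * T = 12 * (s\<^sup>2 * Q)" by (simp add: TQ power2_eq_square)
      moreover have "s\<^sup>2 * Q \<ge> 0" using Q0 by simp
      ultimately show "(s + 2 * s\<^sup>2) * M + 3 * s\<^sup>2 * Q - s * T \<le> 1 - 3 * s\<^sup>2 * Q"
        unfolding mult.assoc by linarith
    qed
    finally have "measure_pmf.prob P {ys. \<not> total_score S \<nu> ys \<le> T} \<le> err" .
    moreover have "{ys. \<not> total_score S \<nu> ys \<le> T} = UNIV - {ys. total_score S \<nu> ys \<le> T}" by auto
    ultimately show "measure_pmf.expectation (replicate_pmf m p) (accept_score n m B T h) \<ge> 1 - err"
      unfolding ex using measure_pmf.prob_compl[of "{ys. total_score S \<nu> ys \<le> T}" P] by simp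
  }
  {
    assume far: ?far
    have tot: "(\<Sum>b\<in>S. real m * pmf p' b) = (\<Sum>b\<in>S. \<nu> b)"
    proof -
      have "(\<Sum>b\<in>S. real m * pmf p' b) = real m"
        using sum_pmf_eq_1[OF finS setp'] by (simp add: sum_distrib_left[symmetric])
      moreover have "(\<Sum>b\<in>S. \<nu> b) = (\<Sum>i\<in>{1..n}. real m * pmf h i)"
        unfolding \<nu>_def bin_rate_def S_def by (rule sum_bins)
      ultimately show ?thesis using sum_pmf_dist_on[OF h] by (simp add: sum_distrib_left[symmetric])
    qed
    have "(real m * \<epsilon>)\<^sup>2 / (24 * (2 * B)) \<le> M"
      unfolding M_def
    proof (rule sum_score_mean_far[OF finS _ tot])
      show "real m * \<epsilon> \<le> (\<Sum>b\<in>S. \<bar>real m * pmf p' b - \<nu> b\<bar>)"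
        unfolding l1 using far by (intro mult_left_mono) auto
      show "real (card S) \<le> 2 * B"
        using card_bins_le[OF h, of B] Bpos B by (simp add: S_def)
    qed (use \<nu> eps Bpos in auto)
    moreover have "(real m * \<epsilon>)\<^sup>2 / (24 * (2 * B)) = 2 * T" by (simp add: T)
    ultimately have M: "M \<ge> 24 * s * Q" by (simp add: TQ)
    have "measure_pmf.prob P {ys. total_score S \<nu> ys \<le> T} \<le> exp 1 * real m * exp ((- s + 2 * (- s)\<^sup>2) * M + 3 * (- s)\<^sup>2 * Q - (- s) * T)"
      using s by (intro chernoff) (auto simp: mult_nonneg_nonpos)
    also have "\<dots> \<le> err"
    proof (rule errI)
      have "(3 / 4 * s) * (24 * s * Q) \<le> (s - 2 * s\<^sup>2) * M"
        using s s2 M Q0 by (intro mult_mono) auto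
      moreover have "(3 / 4 * s) * (24 * s * Q) = 18 * (s\<^sup>2 * Q)" by (simp add: power2_eq_square)
      moreover have "s * T = 12 * (s\<^sup>2 * Q)" by (simp add: TQ power2_eq_square)
      moreover have "(- s + 2 * (- s)\<^sup>2) * M + 3 * (- s)\<^sup>2 * Q - (- s) * T = - ((s - 2 * s\<^sup>2) * M) + 3 * (s\<^sup>2 * Q) + s * T"
        by (simp add: algebra_simps)
      moreover have "s\<^sup>2 * Q \<ge> 0" using Q0 by simp
      ultimately show "(- s + 2 * (- s)\<^sup>2) * M + 3 * (- s)\<^sup>2 * Q - (- s) * T \<le> 1 - 3 * s\<^sup>2 * Q"
        unfolding mult.assoc by linarith
    qed
    finally show "measure_pmf.expectation (replicate_pmf m p) (accept_score n m B T h) \<le> err"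
      unfolding ex .
  }
qed

section \<open>Testers\<close>
definition mixtures :: "nat \<Rightarrow> nat \<Rightarrow> nat pmf \<Rightarrow> nat pmf set" where
  "mixtures n k q = {h. dist_on n h \<and>
     (\<exists>\<alpha>\<in>{0..1}. \<exists>r. flat_dist n k r \<and> (\<forall>i\<in>{1..n}. pmf h i = mix \<alpha> q r i))}"

definition tests_mixtures :: "nat \<Rightarrow> nat \<Rightarrow> real \<Rightarrow> nat pmf \<Rightarrow> nat \<Rightarrow> tester \<Rightarrow> bool" where
  "tests_mixtures n k \<epsilon> q m A \<longleftrightarrow> (\<forall>p. dist_on n p \<longrightarrow>
     (p \<in> mixtures n k q \<longrightarrow> pmf (run_tester m A p) Accept \<ge> 2/3) \<and>
     ((\<forall>h\<in>mixtures n k q. l1_norm n (\<lambda>i. pmf p i - pmf h i) \<ge> \<epsilon>) \<longrightarrow>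
        pmf (run_tester m A p) Reject \<ge> 2/3))"

definition coin_tester :: "(nat list \<Rightarrow> real) \<Rightarrow> tester" where
  "coin_tester v xs = map_pmf (\<lambda>b. if b then Accept else Reject) (bernoulli_pmf (v xs))"

lemma pmf_run_coin_tester:
  assumes v: "\<And>xs. 0 \<le> v xs \<and> v xs \<le> 1"
  shows "pmf (run_tester m (coin_tester v) p) Accept = measure_pmf.expectation (replicate_pmf m p) v"
    and "pmf (run_tester m (coin_tester v) p) Reject = 1 - measure_pmf.expectation (replicate_pmf m p) v"
proof -
  have inj: "inj (\<lambda>b. if b then Accept else Reject)" by (auto simp: inj_on_def split: if_splits)
  have "pmf (coin_tester v xs) Accept = v xs" for xs
    using pmf_map_inj'[OF inj, of "bernoulli_pmf (v xs)" True] v by (simp add: coin_tester_def)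
  then show acc: "pmf (run_tester m (coin_tester v) p) Accept = measure_pmf.expectation (replicate_pmf m p) v"
    by (simp add: run_tester_def pmf_bind)
  have "(\<Sum>x\<in>{Accept, Reject}. pmf (run_tester m (coin_tester v) p) x) = 1"
    by (rule sum_pmf_eq_1) (use verdict.exhaust in auto)
  then show "pmf (run_tester m (coin_tester v) p) Reject = 1 - measure_pmf.expectation (replicate_pmf m p) v"
    using acc by simp
qed

lemma finite_replicate_dist_on:
  assumes "dist_on n p"
  shows "finite (set_pmf (replicate_pmf m p))"
  using assms finite_subset[of "set_pmf p" "{1..n}"]
  by (intro finite_set_replicate_pmf) (simp add: dist_on_def)

section \<open>Many pieces: learning the distribution\<close>

lemma count_mean_variance:
  assumes S: "finite S" "set_pmf p \<subseteq> S" "i \<in> S"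
  shows "measure_pmf.expectation (replicate_pmf m p) (\<lambda>xs. real (count_list xs i) - m * pmf p i) = 0 \<and>
    measure_pmf.expectation (replicate_pmf m p) (\<lambda>xs. (real (count_list xs i) - m * pmf p i)\<^sup>2) = m * (pmf p i * (1 - pmf p i))"
proof (induction m)
  case (Suc m)
  let ?E = "measure_pmf.expectation (replicate_pmf m p)"
  let ?Y = "\<lambda>xs. real (count_list xs i) - m * pmf p i"
  let ?d = "\<lambda>a. (if a = i then 1 else 0) - pmf p i"
  have one: "(\<Sum>a\<in>S. pmf p a) = 1" using S by (simp add: sum_pmf_eq_1)
  have int: "integrable (replicate_pmf m p) f" for f :: "'a list \<Rightarrow> real"
    by (intro integrable_measure_pmf_finite finite_set_replicate_pmf) (use S finite_subset in blast)
  have step: "real (count_list (a # xs) i) - real (Suc m) * pmf p i = ?d a + ?Y xs" for a xs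
    by (simp add: algebra_simps)
  have d1: "(\<Sum>a\<in>S. pmf p a * ?d a) = 0"
  proof -
    have "(\<Sum>a\<in>S. pmf p a * ?d a) = (\<Sum>a\<in>S. (if a = i then pmf p i else 0) - pmf p a * pmf p i)"
      by (intro sum.cong) (auto simp: algebra_simps)
    also have "\<dots> = 0" using S one by (simp add: sum_subtractf sum_distrib_right[symmetric])
    finally show ?thesis .
  qed
  have d2: "(\<Sum>a\<in>S. pmf p a * (?d a)\<^sup>2) = pmf p i * (1 - pmf p i)"
  proof -
    have "(\<Sum>a\<in>S. pmf p a * (?d a)\<^sup>2) = (\<Sum>a\<in>S. (if a = i then pmf p i * (1 - 2 * pmf p i) else 0) + pmf p a * (pmf p i)\<^sup>2)"
      by (intro sum.cong) (auto simp: algebra_simps power2_eq_square)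
    also have "\<dots> = pmf p i * (1 - 2 * pmf p i) + (pmf p i)\<^sup>2"
      using S one by (simp add: sum.distrib sum_distrib_right[symmetric])
    finally show ?thesis by (simp add: algebra_simps power2_eq_square)
  qed
  have mean: "?E (\<lambda>xs. ?d a + ?Y xs) = ?d a" for a
    using Suc by (simp only: Bochner_Integration.integral_add[OF int int]) simp
  have var: "?E (\<lambda>xs. (?d a + ?Y xs)\<^sup>2) = (?d a)\<^sup>2 + m * (pmf p i * (1 - pmf p i))" for a
  proof -
    have "?E (\<lambda>xs. (?d a + ?Y xs)\<^sup>2) = ?E (\<lambda>xs. ((?d a)\<^sup>2 + 2 * ?d a * ?Y xs) + (?Y xs)\<^sup>2)"
      by (simp only: power2_sum add_ac mult_ac)
    also have "\<dots> = ((?d a)\<^sup>2 + 2 * ?d a * ?E ?Y) + ?E (\<lambda>xs. (?Y xs)\<^sup>2)"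
      by (simp only: Bochner_Integration.integral_add[OF int int] integral_mult_right_zero) simp
    also have "\<dots> = (?d a)\<^sup>2 + m * (pmf p i * (1 - pmf p i))" using Suc by simp
    finally show ?thesis .
  qed
  show ?case
    unfolding expectation_replicate_Suc[OF S(1,2)] step mean var distrib_left sum.distrib
      d1 d2 sum_distrib_right[symmetric] one by (simp add: algebra_simps)
qed simp

text \<open>
  The expected \<open>\<ell>\<^sub>1\<close> error is at most \<open>sqrt (n / m)\<close>, by the variances of the counts. Instead of
  Jensen's inequality, \<open>\<bar>t\<bar> \<le> t\<^sup>2 / (2 c) + c / 2\<close> is used; for \<open>m = 36 n / \<epsilon>\<^sup>2\<close> the value
  \<open>c = \<epsilon> / (6 n)\<close> balances the two terms.
\<close>
lemma empirical_l1_tail: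
  fixes \<epsilon> :: real
  assumes p: "dist_on n p" and n: "n \<ge> 1" and \<epsilon>: "\<epsilon> > 0" and m: "real m \<ge> 36 * n / \<epsilon>\<^sup>2"
  shows "measure_pmf.prob (replicate_pmf m p)
      {xs. l1_norm n (\<lambda>i. real (count_list xs i) / m - pmf p i) \<ge> \<epsilon> / 2} \<le> 1 / 3"
proof -
  define c where "c = \<epsilon> / (6 * n)"
  have c: "c > 0" using n \<epsilon> by (simp add: c_def)
  have "36 * real n / \<epsilon>\<^sup>2 > 0" using n \<epsilon> by simp
  then have mpos: "real m > 0" using m by linarith
  let ?y = "\<lambda>i xs. real (count_list xs i) / m - pmf p i"
  let ?l = "\<lambda>xs. l1_norm n (\<lambda>i. ?y i xs)"
  let ?E = "measure_pmf.expectation (replicate_pmf m p)"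
  have int: "integrable (replicate_pmf m p) f" for f :: "nat list \<Rightarrow> real"
    by (intro integrable_measure_pmf_finite finite_replicate_dist_on[OF p])
  have Ey: "?E (\<lambda>xs. (?y i xs)\<^sup>2) \<le> pmf p i / m" if i: "i \<in> {1..n}" for i
  proof -
    have "?E (\<lambda>xs. (?y i xs)\<^sup>2) = ?E (\<lambda>xs. (real (count_list xs i) - m * pmf p i)\<^sup>2 / (real m)\<^sup>2)"
      using mpos by (intro arg_cong[of _ _ ?E] ext) (simp add: field_simps flip: power_divide)
    also have "\<dots> = m * (pmf p i * (1 - pmf p i)) / (real m)\<^sup>2"
      using count_mean_variance[of "{1..n}" p i m] p i by (simp add: dist_on_def)
    also have "\<dots> \<le> m * (pmf p i * 1) / (real m)\<^sup>2"
      by (intro divide_right_mono mult_left_mono) auto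
    also have "\<dots> = pmf p i / m" using mpos by (simp add: power2_eq_square)
    finally show ?thesis .
  qed
  have amgm: "\<bar>t\<bar> \<le> t\<^sup>2 / (2 * c) + c / 2" for t
  proof -
    have "0 \<le> (\<bar>t\<bar> - c)\<^sup>2" by simp
    then have "2 * c * \<bar>t\<bar> \<le> t\<^sup>2 + c\<^sup>2" by (simp add: power2_diff mult_ac)
    then show ?thesis using c by (simp add: field_simps power2_eq_square)
  qed
  have "?E ?l \<le> ?E (\<lambda>xs. \<Sum>i\<in>{1..n}. (?y i xs)\<^sup>2 / (2 * c) + c / 2)"
    unfolding l1_norm_def by (intro integral_mono int sum_mono amgm)
  also have "\<dots> = (\<Sum>i\<in>{1..n}. ?E (\<lambda>xs. (?y i xs)\<^sup>2) / (2 * c) + c / 2)"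
    by (simp add: Bochner_Integration.integral_sum[OF int] Bochner_Integration.integral_add[OF int int])
  also have "\<dots> \<le> (\<Sum>i\<in>{1..n}. pmf p i / m / (2 * c) + c / 2)"
    using c by (intro sum_mono add_right_mono divide_right_mono Ey) auto
  also have "\<dots> = 1 / m / (2 * c) + n * c / 2"
    using sum_pmf_dist_on[OF p] by (simp add: sum.distrib sum_divide_distrib[symmetric])
  also have "\<dots> = 3 * n / (m * \<epsilon>) + \<epsilon> / 12"
    using n \<epsilon> mpos by (simp add: c_def field_simps)
  also have "3 * n / (m * \<epsilon>) \<le> \<epsilon> / 12"
    using m mpos \<epsilon> by (simp add: field_simps power2_eq_square)
  finally have El: "?E ?l \<le> \<epsilon> / 6" by simp
  have "\<epsilon> / 2 * measure_pmf.prob (replicate_pmf m p) {xs. ?l xs \<ge> \<epsilon> / 2}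
      = ?E (\<lambda>xs. \<epsilon> / 2 * indicator {xs. ?l xs \<ge> \<epsilon> / 2} xs)" by simp
  also have "\<dots> \<le> ?E ?l"
    by (intro integral_mono int) (auto simp: indicator_def l1_norm_def intro!: sum_nonneg)
  finally have "\<epsilon> * measure_pmf.prob (replicate_pmf m p) {xs. ?l xs \<ge> \<epsilon> / 2} \<le> \<epsilon> * (1 / 3)"
    using El by linarith
  then show ?thesis by (rule mult_left_le_imp_le) (rule \<epsilon>)
qed

lemma l1_norm_triangle:
  "l1_norm n (\<lambda>i. f i - h i) \<le> l1_norm n (\<lambda>i. g i - f i) + l1_norm n (\<lambda>i. g i - h i)"
  unfolding l1_norm_def sum.distrib[symmetric] by (intro sum_mono) linarith

lemma learning_tester:
  fixes \<epsilon> :: real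
  assumes n: "n \<ge> 1" and \<epsilon>: "\<epsilon> > 0" and m: "real m \<ge> 36 * n / \<epsilon>\<^sup>2"
  shows "\<exists>A. tests_mixtures n k \<epsilon> q m A"
proof -
  let ?emp = "\<lambda>xs i. real (count_list xs i) / m"
  define v where "v xs = (if \<exists>h\<in>mixtures n k q. l1_norm n (\<lambda>i. ?emp xs i - pmf h i) < \<epsilon> / 2 then 1 else 0 :: real)" for xs
  have v: "\<And>xs. 0 \<le> v xs \<and> v xs \<le> 1" by (simp add: v_def)
  have "tests_mixtures n k \<epsilon> q m (coin_tester v)"
    unfolding tests_mixtures_def
  proof (intro allI impI conjI)
    fix p assume p: "dist_on n p"
    let ?E = "measure_pmf.expectation (replicate_pmf m p)"
    let ?bad = "{xs. l1_norm n (\<lambda>i. ?emp xs i - pmf p i) \<ge> \<epsilon> / 2}"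
    have int: "integrable (replicate_pmf m p) f" for f :: "nat list \<Rightarrow> real"
      by (intro integrable_measure_pmf_finite finite_replicate_dist_on[OF p])
    have bad: "?E (indicator ?bad) \<le> (1 / 3 :: real)" using empirical_l1_tail[OF p n \<epsilon> m] by simp
    show "pmf (run_tester m (coin_tester v) p) Accept \<ge> 2/3" if "p \<in> mixtures n k q"
    proof -
      have "1 - ?E (indicator ?bad) = ?E (\<lambda>xs. 1 - indicator ?bad xs :: real)"
        by (subst Bochner_Integration.integral_diff[OF int int]) simp
      also have "\<dots> \<le> ?E v"
        by (intro integral_mono int) (use that in \<open>auto simp: v_def indicator_def not_le\<close>)
      finally show ?thesis using bad by (simp add: pmf_run_coin_tester[OF v])
    qed
    show "pmf (run_tester m (coin_tester v) p) Reject \<ge> 2/3"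
      if far: "\<forall>h\<in>mixtures n k q. l1_norm n (\<lambda>i. pmf p i - pmf h i) \<ge> \<epsilon>"
    proof -
      have "?E v \<le> ?E (indicator ?bad)"
      proof (intro integral_mono int)
        fix xs
        show "v xs \<le> indicator ?bad xs"
        proof (cases "\<exists>h\<in>mixtures n k q. l1_norm n (\<lambda>i. ?emp xs i - pmf h i) < \<epsilon> / 2")
          case True
          then obtain h where h: "h \<in> mixtures n k q" "l1_norm n (\<lambda>i. ?emp xs i - pmf h i) < \<epsilon> / 2" by blast
          have "\<epsilon> \<le> l1_norm n (\<lambda>i. pmf p i - pmf h i)" using far h by blast
          also have "\<dots> \<le> l1_norm n (\<lambda>i. ?emp xs i - pmf p i) + l1_norm n (\<lambda>i. ?emp xs i - pmf h i)"
            by (rule l1_norm_triangle)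
          finally have "xs \<in> ?bad" using h by simp
          then show ?thesis using v[of xs] by simp
        qed (simp add: v_def)
      qed
      then show ?thesis using bad by (simp add: pmf_run_coin_tester[OF v])
    qed
  qed
  then show ?thesis by blast
qed

section \<open>Few pieces: a small cover of the mixtures\<close>

text \<open>
  A code \<open>(a, l)\<close> stands for the mixing weight \<open>a / D\<close> and a list \<open>l\<close> of intervals with the heights
  \<open>v / D\<close> of the flat part \<open>\<alpha> r\<close>. The list is unordered and nothing forces its intervals to be
  disjoint, so counting codes is counting lists; the missing consistency is put into \<open>encodes\<close>,
  where every listed interval has to be accurate.
\<close>
definition mixture_codes :: "nat \<Rightarrow> nat \<Rightarrow> nat \<Rightarrow> (nat \<times> (nat set \<times> nat) list) set" where
  "mixture_codes n k D = {0..D} \<times>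
     {l. set l \<subseteq> (\<lambda>(a, b). {a..b}) ` ({0..n} \<times> {0..n}) \<times> {0..D} \<and> length l = k}"

definition encodes :: "nat \<Rightarrow> nat pmf \<Rightarrow> nat \<Rightarrow> nat \<times> (nat set \<times> nat) list \<Rightarrow> nat pmf \<Rightarrow> bool" where
  "encodes n q D c h \<longleftrightarrow> (\<forall>i\<in>{1..n}. \<exists>(J, v)\<in>set (snd c). i \<in> J) \<and>
     (\<forall>(J, v)\<in>set (snd c). \<forall>i\<in>J. \<bar>pmf h i - (1 - real (fst c) / D) * pmf q i - real v / D\<bar> \<le> 2 / D)"

lemma mixture_codes_card:
  assumes "k \<ge> 1"
  shows "finite (mixture_codes n k D)" "card (mixture_codes n k D) \<le> ((n + 1) * (D + 1)) ^ (2 * k)"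
proof -
  define I :: "nat set set" where "I = (\<lambda>(a, b). {a..b}) ` ({0..n} \<times> {0..n})"
  have finI: "finite (I \<times> {0..D})" by (simp add: I_def)
  have "card I \<le> card ({0..n} \<times> {0..n})" unfolding I_def by (rule card_image_le) simp
  then have "card I \<le> (n + 1) * (n + 1)" by (simp add: card_cartesian_product)
  then have "card I * (D + 1) \<le> (n + 1) * (n + 1) * (D + 1)" by (rule mult_le_mono1)
  then have cI: "card (I \<times> {0..D}) \<le> (n + 1) * (n + 1) * (D + 1)" by (simp add: card_cartesian_product)
  show "finite (mixture_codes n k D)"
    unfolding mixture_codes_def I_def[symmetric] using finite_lists_length_eq[OF finI] by simp
  have "card (mixture_codes n k D) = (D + 1) * card (I \<times> {0..D}) ^ k"
    unfolding mixture_codes_def I_def[symmetric] card_cartesian_product[of "{0..D}"] card_lists_length_eq[OF finI] by simp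
  also have "\<dots> \<le> (D + 1) ^ k * ((n + 1) * (n + 1) * (D + 1)) ^ k"
    using cI self_le_power[of "D + 1" k] assms by (intro mult_mono power_mono) auto
  also have "\<dots> = ((n + 1) * (D + 1)) ^ (2 * k)"
    unfolding power_mult power_mult_distrib[symmetric] by (simp only: power2_eq_square mult_ac)
  finally show "card (mixture_codes n k D) \<le> ((n + 1) * (D + 1)) ^ (2 * k)" .
qed

text \<open>
  Two distributions with a common code are close to each other. The cover can therefore consist of
  one mixture per code, and no code has to be turned into a distribution by rounding.
\<close>
lemma encodes_close:
  assumes "encodes n q D c h" "encodes n q D c h'" "i \<in> {1..n}"
  shows "\<bar>pmf h i - pmf h' i\<bar> \<le> 4 / D"
proof -
  obtain J v where J: "(J, v) \<in> set (snd c)" "i \<in> J" using assms(1,3) unfolding encodes_def by blast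
  have "\<bar>pmf g i - (1 - real (fst c) / D) * pmf q i - real v / D\<bar> \<le> 2 / D" if "encodes n q D c g" for g
    using that J unfolding encodes_def by blast
  from this[OF assms(1)] this[OF assms(2)] show ?thesis by (simp add: abs_le_iff)
qed

lemma floor_grid:
  fixes x :: real
  assumes "0 \<le> x" "x \<le> 1" "D \<ge> 1"
  shows "nat \<lfloor>x * real D\<rfloor> \<le> D" "\<bar>x - real (nat \<lfloor>x * real D\<rfloor>) / D\<bar> \<le> 1 / D"
proof -
  have 0: "0 \<le> x * real D" using assms by simp
  have 1: "x * real D \<le> 1 * real D" using assms by (intro mult_right_mono) auto
  have 2: "real (nat \<lfloor>x * real D\<rfloor>) = of_int \<lfloor>x * real D\<rfloor>" using 0 by simp
  have "real (nat \<lfloor>x * real D\<rfloor>) \<le> real D" unfolding 2 using 1 by linarith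
  then show "nat \<lfloor>x * real D\<rfloor> \<le> D" by simp
  have "\<bar>x * real D - of_int \<lfloor>x * real D\<rfloor>\<bar> \<le> 1" by linarith
  then have "\<bar>x * real D - of_int \<lfloor>x * real D\<rfloor>\<bar> / D \<le> 1 / D" by (intro divide_right_mono) auto
  then show "\<bar>x - real (nat \<lfloor>x * real D\<rfloor>) / D\<bar> \<le> 1 / D"
  proof -
    have "x - of_int \<lfloor>x * real D\<rfloor> / D = (x * real D - of_int \<lfloor>x * real D\<rfloor>) / D"
      using assms by (simp add: field_simps)
    then show ?thesis unfolding 2 using \<open>_ \<le> 1 / real D\<close> by simp
  qed
qed

text \<open>
  Rounding \<open>\<alpha>\<close> costs \<open>1 / D\<close> because \<open>pmf q i \<le> 1\<close>, and rounding the height \<open>\<alpha> * pmf r i\<close>, which is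
  constant on each piece and can be read off at its minimum, costs another \<open>1 / D\<close>.
\<close>
lemma mixture_has_code:
  assumes "p \<in> mixtures n k q" "D \<ge> 1"
  shows "\<exists>c\<in>mixture_codes n k D. encodes n q D c p"
proof -
  obtain \<alpha> r where \<alpha>: "0 \<le> \<alpha>" "\<alpha> \<le> 1" and r: "flat_dist n k r"
    and p: "\<And>i. i \<in> {1..n} \<Longrightarrow> pmf p i = mix \<alpha> q r i"
    using assms(1) by (auto simp: mixtures_def)
  obtain P where P: "partition_on {1..n} P" "card P = k" "\<And>J. J \<in> P \<Longrightarrow> \<exists>a b. J = {a..b}"
    and const: "\<And>J. J \<in> P \<Longrightarrow> pmf r constant_on J"
    using r by (auto simp: flat_dist_def flat_def segmentation_def)
  have finP: "finite P" using P(1) by (rule finite_elements[rotated]) simp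
  obtain Js where Js: "set Js = P" "distinct Js" using finite_distinct_list[OF finP] by blast
  have len: "length Js = k" using distinct_card[OF Js(2)] Js(1) P(2) by simp
  define w where "w J = nat \<lfloor>\<alpha> * pmf r (Min J) * real D\<rfloor>" for J
  have \<alpha>r: "0 \<le> \<alpha> * pmf r i \<and> \<alpha> * pmf r i \<le> 1" for i
    using \<alpha> mult_mono[of \<alpha> 1 "pmf r i" 1] by (simp add: pmf_le_1)
  define c where "c = (nat \<lfloor>\<alpha> * real D\<rfloor>, map (\<lambda>J. (J, w J)) Js)"
  have "c \<in> mixture_codes n k D"
  proof -
    have "J \<in> (\<lambda>(a, b). {a..b}) ` ({0..n} \<times> {0..n})" if J: "J \<in> P" for J
    proof -
      obtain a b where ab: "J = {a..b}" using P(3)[OF J] by blast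
      have "J \<noteq> {}" "J \<subseteq> {1..n}" using P(1) J by (auto simp: partition_on_def)
      then have "a \<le> b" "b \<in> {1..n}" using ab by auto
      then show ?thesis using ab by (intro image_eqI[of _ _ "(a, b)"]) auto
    qed
    moreover have "w J \<le> D" for J unfolding w_def using \<alpha>r assms(2) by (intro floor_grid(1)) auto
    moreover have "nat \<lfloor>\<alpha> * real D\<rfloor> \<le> D" using \<alpha> assms(2) by (intro floor_grid(1)) auto
    ultimately show ?thesis using Js(1) len by (auto simp: c_def mixture_codes_def)
  qed
  moreover have "encodes n q D c p"
    unfolding encodes_def
  proof (intro conjI ballI)
    fix i assume "i \<in> {1..n}"
    then have "i \<in> \<Union>P" using P(1) by (simp add: partition_on_def)
    then obtain J where "J \<in> P" "i \<in> J" by blast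
    then show "\<exists>(J, v)\<in>set (snd c). i \<in> J" using Js(1) by (auto simp: c_def)
  next
    fix Jv assume "Jv \<in> set (snd c)"
    then obtain J where J: "Jv = (J, w J)" "J \<in> P" using Js(1) by (auto simp: c_def)
    have "\<bar>pmf p i - (1 - real (fst c) / D) * pmf q i - real (w J) / D\<bar> \<le> 2 / D" if i: "i \<in> J" for i
    proof -
      have sub: "J \<subseteq> {1..n}" using P(1) J by (auto simp: partition_on_def)
      then have "Min J \<in> J" using i finite_subset by (intro Min_in) auto
      then have ri: "pmf r i = pmf r (Min J)" using const[OF J(2)] i unfolding constant_on_def by metis
      have x: "\<bar>(\<alpha> - real (fst c) / D) * pmf q i\<bar> \<le> 1 / D * 1"
        unfolding c_def fst_conv abs_mult using \<alpha> assms(2) by (intro mult_mono floor_grid(2)) (auto simp: pmf_le_1)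
      have y: "\<bar>\<alpha> * pmf r i - real (w J) / D\<bar> \<le> 1 / D"
        unfolding w_def ri using \<alpha>r assms(2) by (intro floor_grid(2)) auto
      have "pmf p i - (1 - real (fst c) / D) * pmf q i - real (w J) / D
          = (\<alpha> * pmf r i - real (w J) / D) - (\<alpha> - real (fst c) / D) * pmf q i"
        using p[of i] sub i by (simp add: mix_def subset_iff algebra_simps)
      also have "\<bar>\<dots>\<bar> \<le> 1 / D + 1 / D * 1"
        by (rule order_trans[OF abs_triangle_ineq4 add_mono[OF y x]])
      finally show ?thesis by simp
    qed
    then show "case Jv of (J, v) \<Rightarrow> \<forall>i\<in>J. \<bar>pmf p i - (1 - real (fst c) / D) * pmf q i - real v / D\<bar> \<le> 2 / D"
      using J by simp
  qed
  ultimately show ?thesis by blast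
qed

lemma mixtures_cover:
  assumes k: "k \<ge> 1" and D: "D \<ge> 1"
  obtains H where "finite H" "H \<subseteq> mixtures n k q" "card H \<le> ((n + 1) * (D + 1)) ^ (2 * k)"
    "\<And>p. p \<in> mixtures n k q \<Longrightarrow> \<exists>h\<in>H. l1_norm n (\<lambda>i. pmf p i - pmf h i) \<le> 4 * real n / D"
proof -
  define good where "good c h \<longleftrightarrow> h \<in> mixtures n k q \<and> encodes n q D c h" for c h
  define C where "C = {c\<in>mixture_codes n k D. \<exists>h. good c h}"
  define H where "H = (\<lambda>c. SOME h. good c h) ` C"
  have C: "finite C" "card C \<le> card (mixture_codes n k D)"
    using mixture_codes_card(1)[OF k, of n D] by (auto simp: C_def intro!: card_mono)
  have some: "good c (SOME h. good c h)" if "c \<in> C" for c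
    using that unfolding C_def by (auto intro: someI_ex)
  show thesis
  proof (rule that)
    show "finite H" using C by (simp add: H_def)
    show "H \<subseteq> mixtures n k q" using some by (auto simp: H_def good_def)
    show "card H \<le> ((n + 1) * (D + 1)) ^ (2 * k)"
      using card_image_le[OF C(1), of "\<lambda>c. SOME h. good c h"] C(2) mixture_codes_card(2)[OF k, of n D]
      unfolding H_def by linarith
    fix p assume p: "p \<in> mixtures n k q"
    obtain c where c: "c \<in> mixture_codes n k D" "encodes n q D c p" using mixture_has_code[OF p D] by blast
    then have cC: "c \<in> C" using p by (auto simp: C_def good_def)
    define h where "h = (SOME h. good c h)"
    have h: "encodes n q D c h" "h \<in> H" using some[OF cC] cC by (auto simp: h_def H_def good_def)
    have "l1_norm n (\<lambda>i. pmf p i - pmf h i) \<le> (\<Sum>i\<in>{1..n}. 4 / D)"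
      unfolding l1_norm_def by (intro sum_mono encodes_close[OF c(2) h(1)])
    then show "\<exists>h\<in>H. l1_norm n (\<lambda>i. pmf p i - pmf h i) \<le> 4 * real n / D"
      using h(2) by (intro bexI[of _ h]) (auto simp: mult.commute)
  qed
qed

text \<open>
  The grid \<open>D = 4 n m\<close> makes the cover so fine that \<open>m\<close> times its \<open>\<ell>\<^sub>1\<close> error is at most \<open>1\<close>, as
  needed for the near case of the identity test. The acceptance probability is the sum of those of
  the individual tests, cut off at \<open>1\<close>: it dominates each of them and is dominated by their sum.
\<close>
lemma cover_tester:
  fixes \<epsilon> :: real
  assumes k: "k \<ge> 1" and n: "n \<ge> 1" and m: "m \<ge> 1" and \<epsilon>: "0 < \<epsilon>" "\<epsilon> \<le> 2"
    and err: "3 * real (((n + 1) * (4 * n * m + 1)) ^ (2 * k)) *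
      (exp 2 * real m * exp (- ((real m * \<epsilon>\<^sup>2)\<^sup>2 / (442368 * real (max n m))))) \<le> 1"
  shows "\<exists>A. tests_mixtures n k \<epsilon> q m A"
proof -
  define D where "D = 4 * n * m"
  define B where "B = real (max n m)"
  define T where "T = (real m * \<epsilon>)\<^sup>2 / (96 * B)"
  define e where "e = exp 2 * real m * exp (- ((real m * \<epsilon>\<^sup>2)\<^sup>2 / (442368 * B)))"
  define N where "N = ((n + 1) * (D + 1)) ^ (2 * k)"
  have D1: "D \<ge> 1" using n m by (simp add: D_def)
  obtain H where H: "finite H" "H \<subseteq> mixtures n k q" "card H \<le> N"
    and cover: "\<And>p. p \<in> mixtures n k q \<Longrightarrow> \<exists>h\<in>H. l1_norm n (\<lambda>i. pmf p i - pmf h i) \<le> 4 * real n / D"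
    unfolding N_def by (rule mixtures_cover[OF k D1, where n = n and q = q]) blast
  have Ne: "3 * real N * e \<le> 1" using err by (simp only: N_def D_def e_def B_def)
  have e0: "e \<ge> 0" by (simp add: e_def)
  have N1: "real N \<ge> 1" unfolding N_def using of_nat_mono[OF one_le_power[of "(n + 1) * (D + 1)" "2 * k"]] by simp
  have "3 * 1 * e \<le> 3 * real N * e" using N1 e0 by (intro mult_right_mono) auto
  then have e3: "e \<le> 1 / 3" using Ne by linarith
  define f where "f = accept_score n m B T"
  define v where "v xs = min 1 (\<Sum>h\<in>H. f h xs)" for xs
  have f0: "f h xs \<ge> 0" "f h xs \<le> 1" for h xs by (simp_all add: f_def accept_score_def)
  have v: "\<And>xs. 0 \<le> v xs \<and> v xs \<le> 1" using f0 by (auto simp: v_def intro!: sum_nonneg)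
  have distH: "dist_on n h" if "h \<in> H" for h using that H by (auto simp: mixtures_def)
  have B: "real m \<le> B" "real n \<le> B" by (auto simp: B_def)
  have "tests_mixtures n k \<epsilon> q m (coin_tester v)"
    unfolding tests_mixtures_def
  proof (intro allI impI conjI)
    fix p assume p: "dist_on n p"
    let ?E = "measure_pmf.expectation (replicate_pmf m p)"
    have int: "integrable (replicate_pmf m p) f" for f :: "nat list \<Rightarrow> real"
      by (intro integrable_measure_pmf_finite finite_replicate_dist_on[OF p])
    show "pmf (run_tester m (coin_tester v) p) Accept \<ge> 2/3" if mx: "p \<in> mixtures n k q"
    proof -
      obtain h where h: "h \<in> H" "l1_norm n (\<lambda>i. pmf p i - pmf h i) \<le> 4 * real n / D" using cover[OF mx] by blast
      have "real m * l1_norm n (\<lambda>i. pmf p i - pmf h i) \<le> real m * (4 * real n / D)"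
        using h by (intro mult_left_mono) auto
      also have "\<dots> = 1" using n m by (simp add: D_def)
      finally have "?E (f h) \<ge> 1 - e"
        unfolding f_def using accept_score_errors(1)[OF distH[OF h(1)] p m B \<epsilon> T_def e_def] by simp
      moreover have "?E (f h) \<le> ?E v"
      proof (intro integral_mono int)
        fix xs
        have "f h xs \<le> (\<Sum>h\<in>H. f h xs)" using h H f0 by (intro member_le_sum) auto
        then show "f h xs \<le> v xs" using f0[of h xs] by (simp add: v_def)
      qed
      ultimately show ?thesis using e3 by (simp add: pmf_run_coin_tester[OF v])
    qed
    show "pmf (run_tester m (coin_tester v) p) Reject \<ge> 2/3"
      if far: "\<forall>h\<in>mixtures n k q. l1_norm n (\<lambda>i. pmf p i - pmf h i) \<ge> \<epsilon>"
    proof -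
      have "?E v \<le> ?E (\<lambda>xs. \<Sum>h\<in>H. f h xs)" by (intro integral_mono int) (simp add: v_def)
      also have "\<dots> = (\<Sum>h\<in>H. ?E (f h))" by (intro Bochner_Integration.integral_sum int)
      also have "\<dots> \<le> (\<Sum>h\<in>H. e)"
      proof (intro sum_mono)
        fix h assume h: "h \<in> H"
        then have "l1_norm n (\<lambda>i. pmf p i - pmf h i) \<ge> \<epsilon>" using far H by blast
        then show "?E (f h) \<le> e"
          unfolding f_def by (rule accept_score_errors(2)[OF distH[OF h] p m B \<epsilon> T_def e_def])
      qed
      also have "\<dots> \<le> real N * e" using H e0 by (simp add: mult_right_mono)
      also have "\<dots> \<le> 1 / 3" using Ne by simp
      finally show ?thesis by (simp add: pmf_run_coin_tester[OF v])
    qed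
  qed
  then show ?thesis by blast
qed

section \<open>The sample size\<close>

text \<open>
  Here \<open>e = sqrt \<epsilon>\<close>, so that \<open>\<epsilon>\<close> to the power \<open>7/2\<close> is \<open>e ^ 7\<close>, and \<open>w = sqrt (n k)\<close>. The logarithm of the
  size of the cover is at most a constant times \<open>k \<Lambda>\<close>, since \<open>m\<close> is at most a constant times
  \<open>exp (6 \<Lambda>)\<close>. The exponent \<open>a\<close> of the identity test exceeds it in both cases of \<open>max n m\<close>: up to
  constants, \<open>m\<^sup>2 \<epsilon>\<^sup>4 / n\<close> is at least \<open>k \<Lambda>\<^sup>2 / \<epsilon>\<^sup>3\<close>, and \<open>m \<epsilon>\<^sup>4\<close> is at least
  \<open>sqrt (n k \<epsilon>) \<Lambda>\<close>, which is where \<open>k \<le> n \<epsilon>\<close> enters. The factor \<open>2 ^ 30\<close> makes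
  \<open>a \<ge> 300 k \<Lambda>\<close>, against about \<open>125 k \<Lambda>\<close> for everything else.
\<close>
lemma main_regime_error:
  fixes e w \<Lambda> y :: real and n k m :: nat
  assumes k: "1 \<le> k" "k \<le> n" and e: "0 < e" "e\<^sup>2 \<le> 2" and reg: "real k \<le> n * e\<^sup>2"
    and w: "w \<ge> 0" "w\<^sup>2 = real n * real k"
    and \<Lambda>: "\<Lambda> \<ge> 1" "exp \<Lambda> = 2 + real n + 1 / e\<^sup>2"
    and y: "y = w / e ^ 7 * \<Lambda>" and m: "2 ^ 30 * y \<le> real m" "real m \<le> 2 ^ 31 * y"
  shows "3 * real (((n + 1) * (4 * n * m + 1)) ^ (2 * k)) *
      (exp 2 * real m * exp (- ((real m * (e\<^sup>2)\<^sup>2)\<^sup>2 / (442368 * real (max n m))))) \<le> 1"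
proof -
  define X where "X = exp \<Lambda>"
  have n: "real n \<ge> 1" using k by simp
  have y0: "y \<ge> 0" using w e \<Lambda> by (simp add: y)
  have X: "X \<ge> 1" "X \<ge> n + 1" "X \<ge> 1 / e\<^sup>2" "X \<ge> \<Lambda>" "X \<ge> n"
    using \<Lambda> e n exp_ge_add_one_self[of \<Lambda>] by (auto simp: X_def)
  have wn: "w \<le> n"
  proof (rule power2_le_imp_le)
    have "real n * real k \<le> real n * real n" using k by (intro mult_left_mono) auto
    then show "w\<^sup>2 \<le> (real n)\<^sup>2" unfolding w by (simp add: power2_eq_square)
  qed auto
  have we: "real k \<le> w * e"
  proof (rule power2_le_imp_le)
    have "real k * real k \<le> real k * (n * e\<^sup>2)" using reg by (intro mult_left_mono) auto
    then show "(real k)\<^sup>2 \<le> (w * e)\<^sup>2" by (simp only: power_mult_distrib w) (simp add: power2_eq_square mult_ac)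
  qed (use w e in auto)
  have e6: "e ^ 6 \<le> 8"
  proof -
    have "(e\<^sup>2) ^ 3 \<le> 2 ^ 3" using e by (intro power_mono) auto
    then show ?thesis by (simp flip: power_mult)
  qed
  have inv_e7: "1 / e ^ 7 \<le> X ^ 4"
  proof -
    have "1 / e \<le> X"
    proof (cases "e \<le> 1")
      case True
      have "1 / e \<le> 1 / e\<^sup>2" using True e by (simp add: field_simps power2_eq_square)
      then show ?thesis using X by linarith
    next
      case False
      then have "1 / e \<le> 1" by simp
      then show ?thesis using X by linarith
    qed
    moreover have "(1 / e\<^sup>2) ^ 3 \<le> X ^ 3" using X e by (intro power_mono) auto
    ultimately have "(1 / e\<^sup>2) ^ 3 * (1 / e) \<le> X ^ 3 * X" using X e by (intro mult_mono) auto
    then show ?thesis by (simp add: power_divide power_mult[symmetric] eval_nat_numeral mult_ac)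
  qed
  have "y = w * (1 / e ^ 7) * \<Lambda>" by (simp add: y)
  also have "\<dots> \<le> X * X ^ 4 * X"
    using wn X inv_e7 w e \<Lambda> by (intro mult_mono) auto
  finally have yX: "y \<le> X ^ 6" by (simp add: eval_nat_numeral mult_ac)
  have two: "(2::real) ^ j \<le> exp (real j)" for j
    using power_mono[of "2::real" "exp 1" j] exp_ge_add_one_self[of "1::real"] by (simp add: exp_of_nat_mult[symmetric])
  have mX: "real m \<le> 2 ^ 31 * X ^ 6" using m(2) mult_left_mono[OF yX, of "2 ^ 31"] by simp
  have XL: "X ^ j = exp (j * \<Lambda>)" for j by (simp add: X_def exp_of_nat_mult)
  have m_exp: "real m \<le> exp (31 + 6 * \<Lambda>)"
  proof -
    have "(2::real) ^ 31 * X ^ 6 \<le> exp 31 * X ^ 6" using two[of 31] X by (intro mult_right_mono) auto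
    from order_trans[OF mX this] show ?thesis by (simp add: XL exp_add)
  qed
  have base: "real ((n + 1) * (4 * n * m + 1)) \<le> exp (34 + 8 * \<Lambda>)"
  proof -
    have "4 * real n * real m + 1 \<le> 4 * X * (2 ^ 31 * X ^ 6) + 1"
      using X mX n by (intro add_right_mono mult_mono) auto
    also have "\<dots> \<le> 2 ^ 34 * X ^ 7"
      using one_le_power[OF X(1), of 7] by (simp add: eval_nat_numeral)
    finally have "(real n + 1) * (4 * real n * real m + 1) \<le> X * (2 ^ 34 * X ^ 7)"
      using X n by (intro mult_mono) auto
    also have "\<dots> = 2 ^ 34 * X ^ 8" by (simp add: eval_nat_numeral)
    also have "\<dots> \<le> exp 34 * X ^ 8" using two[of 34] X by (intro mult_right_mono) auto
    finally show ?thesis by (simp add: XL exp_add algebra_simps)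
  qed
  have N: "real (((n + 1) * (4 * n * m + 1)) ^ (2 * k)) \<le> exp (2 * k * (34 + 8 * \<Lambda>))"
  proof -
    have "real (((n + 1) * (4 * n * m + 1)) ^ (2 * k)) \<le> exp (34 + 8 * \<Lambda>) ^ (2 * k)"
      unfolding of_nat_power by (intro power_mono base) auto
    then show ?thesis by (simp flip: exp_of_nat_mult)
  qed
  have kL: "real k * \<Lambda> \<ge> 1" using mult_mono[of 1 "real k" 1 \<Lambda>] k \<Lambda> by simp
  define a where "a = (real m * (e\<^sup>2)\<^sup>2)\<^sup>2 / (442368 * real (max n m))"
  have me: "(real m * (e\<^sup>2)\<^sup>2)\<^sup>2 = (real m)\<^sup>2 * e ^ 8" by (simp add: power_mult_distrib flip: power_mult)
  have "2 ^ 27 * (real k * \<Lambda>) * real (max n m) \<le> (real m)\<^sup>2 * e ^ 8"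
  proof (cases "m \<le> n")
    case True
    have "2 ^ 27 * (real k * \<Lambda>) * real n * e ^ 6 \<le> 2 ^ 27 * (real k * \<Lambda>) * real n * 8"
      using e6 \<Lambda> by (intro mult_left_mono) auto
    also have "\<dots> \<le> (2 ^ 30)\<^sup>2 * (real n * real k) * (\<Lambda> * \<Lambda>)"
    proof -
      have "real n * real k * \<Lambda> * 1 \<le> real n * real k * \<Lambda> * \<Lambda>" using \<Lambda> by (intro mult_left_mono) auto
      moreover have "0 \<le> real n * real k * \<Lambda> * \<Lambda>" using \<Lambda> by simp
      ultimately show ?thesis by (simp add: mult_ac)
    qed
    also have "\<dots> = (2 ^ 30 * y * e ^ 7)\<^sup>2"
      using e by (simp add: y w(2)[symmetric] power_mult_distrib power2_eq_square)
    also have "\<dots> \<le> (real m * e ^ 7)\<^sup>2"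
      using m y0 e by (intro power_mono mult_right_mono) auto
    also have "\<dots> = (real m)\<^sup>2 * e ^ 8 * e ^ 6" by (simp add: power_mult_distrib flip: power_mult power_add)
    finally have "2 ^ 27 * (real k * \<Lambda>) * real n \<le> (real m)\<^sup>2 * e ^ 8" using e by (simp add: mult_le_cancel_right)
    then show ?thesis using True by (simp add: max_def)
  next
    case False
    have "2 ^ 27 * (real k * \<Lambda>) \<le> 2 ^ 30 * (w * e * \<Lambda>)"
    proof (rule mult_mono)
      show "real k * \<Lambda> \<le> w * e * \<Lambda>" using we \<Lambda> by (intro mult_right_mono) auto
    qed (use \<Lambda> in auto)
    also have "\<dots> = 2 ^ 30 * y * e ^ 8" using e by (simp add: y eval_nat_numeral)
    also have "\<dots> \<le> real m * e ^ 8" using m e by (intro mult_right_mono) auto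
    finally have "2 ^ 27 * (real k * \<Lambda>) * real m \<le> real m * e ^ 8 * real m" by (intro mult_right_mono) auto
    then show ?thesis using False by (simp add: max_def power2_eq_square mult_ac)
  qed
  then have "2 ^ 27 * (real k * \<Lambda>) \<le> 442368 * a"
    using n by (simp add: a_def me field_simps)
  then have a: "a \<ge> 300 * (real k * \<Lambda>)" using kL by (simp add: mult.commute)
  have "3 * real (((n + 1) * (4 * n * m + 1)) ^ (2 * k)) * (exp 2 * real m * exp (- a))
      \<le> exp 2 * exp (2 * k * (34 + 8 * \<Lambda>)) * (exp 2 * exp (31 + 6 * \<Lambda>) * exp (- a))"
    using N m_exp exp_ge_add_one_self[of "2::real"] by (intro mult_mono) auto
  also have "\<dots> = exp (2 + 2 * k * (34 + 8 * \<Lambda>) + 2 + (31 + 6 * \<Lambda>) - a)"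
    by (simp add: mult_exp_exp algebra_simps)
  also have "\<dots> \<le> exp 0"
  proof -
    have "real k \<le> real k * \<Lambda>" using mult_left_mono[OF \<Lambda>(1), of "real k"] by simp
    moreover have "\<Lambda> \<le> real k * \<Lambda>" using mult_right_mono[of 1 "real k" \<Lambda>] k \<Lambda> by simp
    ultimately have "2 + 2 * k * (34 + 8 * \<Lambda>) + 2 + (31 + 6 * \<Lambda>) - a \<le> 0"
      using a kL by (simp add: algebra_simps)
    then show ?thesis by simp
  qed
  finally show ?thesis by (simp add: a_def)
qed

text \<open>
  For \<open>k > n \<epsilon>\<close>, \<open>sqrt (n k) \<ge> n sqrt \<epsilon>\<close>, so the same sample size is at least of order
  \<open>n / \<epsilon>\<^sup>3\<close>, which is enough for learning.
\<close>
lemma tester_exists: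
  fixes \<epsilon> :: real
  assumes k: "1 \<le> k" "k \<le> n" and \<epsilon>: "\<epsilon> > 0" and q: "dist_on n q"
  shows "\<exists>m A. real m \<le> 2 ^ 31 * (sqrt (real n * real k) / \<epsilon> powr (7/2)) * (ln (2 + real n + 1 / \<epsilon>)) powr 1
    \<and> tests_mixtures n k \<epsilon> q m A"
proof (cases "\<epsilon> \<le> 2")
  case False
  \<comment> \<open>The case distinction avoids having to exhibit a \<open>k\<close>-flat distribution: without any mixture, rejecting is right.\<close>
  define v :: "nat list \<Rightarrow> real" where "v = (\<lambda>_. if mixtures n k q = {} then 0 else 1)"
  have v: "\<And>xs. 0 \<le> v xs \<and> v xs \<le> 1" by (simp add: v_def)
  have "tests_mixtures n k \<epsilon> q 0 (coin_tester v)"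
    unfolding tests_mixtures_def
  proof (intro allI impI conjI)
    fix p assume p: "dist_on n p"
    show "2/3 \<le> pmf (run_tester 0 (coin_tester v) p) Accept" if "p \<in> mixtures n k q"
      unfolding pmf_run_coin_tester[OF v] using that by (auto simp: v_def)
    show "2/3 \<le> pmf (run_tester 0 (coin_tester v) p) Reject"
      if far: "\<forall>h\<in>mixtures n k q. \<epsilon> \<le> l1_norm n (\<lambda>i. pmf p i - pmf h i)"
    proof (cases "mixtures n k q = {}")
      case True
      then show ?thesis unfolding pmf_run_coin_tester[OF v] by (simp add: v_def)
    next
      case ne: False
      then obtain h where h: "h \<in> mixtures n k q" by blast
      then have "dist_on n h" by (simp add: mixtures_def)
      have "l1_norm n (\<lambda>i. pmf p i - pmf h i) \<le> (\<Sum>i\<in>{1..n}. pmf p i + pmf h i)"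
        unfolding l1_norm_def by (intro sum_mono) (smt (verit) pmf_nonneg)
      also have "\<dots> = 2" using sum_pmf_dist_on[OF p] sum_pmf_dist_on[OF \<open>dist_on n h\<close>] by (simp add: sum.distrib)
      finally show ?thesis using far h False by fastforce
    qed
  qed
  moreover have "ln (2 + real n + 1 / \<epsilon>) \<ge> 0" using \<epsilon> by (intro ln_ge_zero) auto
  ultimately show ?thesis by (intro exI[of _ 0] exI) auto
next
  case True
  define e where "e = sqrt \<epsilon>"
  define w where "w = sqrt (real n * real k)"
  define \<Lambda> where "\<Lambda> = ln (2 + real n + 1 / \<epsilon>)"
  define y where "y = w / e ^ 7 * \<Lambda>"
  define m where "m = nat \<lceil>2 ^ 30 * y\<rceil>"
  have e: "0 < e" "e\<^sup>2 = \<epsilon>" using \<epsilon> by (auto simp: e_def)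
  have w: "w \<ge> 1" "w\<^sup>2 = real n * real k"
    using k mult_mono[of 1 "real n" 1 "real k"] by (auto simp: w_def)
  have powr: "\<epsilon> powr (7/2) = e ^ 7"
  proof -
    have "\<epsilon> powr (7/2) = (\<epsilon> powr (1/2)) powr 7" by (simp add: powr_powr)
    also have "\<dots> = e ^ 7" using \<epsilon> by (simp add: e_def powr_half_sqrt powr_numeral)
    finally show ?thesis .
  qed
  have X3: "exp 1 \<le> 2 + real n + 1 / \<epsilon>" using exp_le k \<epsilon> by (smt (verit) divide_pos_pos of_nat_1 of_nat_mono)
  have pos: "0 < 2 + real n + 1 / \<epsilon>" using X3 exp_gt_zero[of "1::real"] by linarith
  have \<Lambda>: "\<Lambda> \<ge> 1" "exp \<Lambda> = 2 + real n + 1 / e\<^sup>2"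
    using X3 pos by (auto simp: \<Lambda>_def e ln_ge_iff)
  have "e\<^sup>2 \<le> 2\<^sup>2" using e True by simp
  then have "e \<le> 2" by (rule power2_le_imp_le) simp
  then have e7: "e ^ 7 \<le> 2 ^ 7" using e by (intro power_mono) auto
  have y: "y \<ge> 1 / 2 ^ 7"
  proof -
    have "1 / 2 ^ 7 \<le> 1 / e ^ 7" using e7 e by (intro divide_left_mono) auto
    also have "\<dots> \<le> w / e ^ 7" using w e by (intro divide_right_mono) auto
    also have "\<dots> \<le> w / e ^ 7 * \<Lambda>" using mult_left_mono[OF \<Lambda>(1), of "w / e ^ 7"] w e by simp
    finally show ?thesis by (simp add: y_def)
  qed
  have m: "2 ^ 30 * y \<le> real m" "real m \<le> 2 ^ 31 * y"
  proof -
    have "real m = of_int \<lceil>2 ^ 30 * y\<rceil>" using y by (simp add: m_def)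
    moreover have "2 ^ 30 * y + 1 \<le> 2 ^ 31 * y" using y by simp
    moreover have "of_int \<lceil>2 ^ 30 * y\<rceil> \<le> 2 ^ 30 * y + 1" "2 ^ 30 * y \<le> of_int \<lceil>2 ^ 30 * y\<rceil>" by linarith+
    ultimately show "2 ^ 30 * y \<le> real m" "real m \<le> 2 ^ 31 * y" by (simp_all only:)
  qed
  have "\<exists>A. tests_mixtures n k \<epsilon> q m A"
  proof (cases "real k \<le> n * \<epsilon>")
    case reg: True
    show ?thesis
    proof (rule cover_tester)
      show "m \<ge> 1" using m(1) y by simp
      show "3 * real (((n + 1) * (4 * n * m + 1)) ^ (2 * k)) *
        (exp 2 * real m * exp (- ((real m * \<epsilon>\<^sup>2)\<^sup>2 / (442368 * real (max n m))))) \<le> 1"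
        using main_regime_error[OF k e(1) _ _ _ w(2) \<Lambda> y_def m] e True reg w by simp
    qed (use k True \<epsilon> in auto)
  next
    case reg: False
    have "real n * e \<le> w"
    proof (rule power2_le_imp_le)
      have "real n * (real n * \<epsilon>) \<le> real n * real k" using reg by (intro mult_left_mono) auto
      then show "(real n * e)\<^sup>2 \<le> w\<^sup>2" by (simp add: w power_mult_distrib e power2_eq_square[of "real n"])
    qed (use w in simp)
    have "36 * real n / \<epsilon>\<^sup>2 \<le> 2 ^ 30 * (real n / (\<epsilon>\<^sup>2 * 2))" using \<epsilon> by (simp add: field_simps)
    also have "\<dots> \<le> 2 ^ 30 * (real n / (\<epsilon>\<^sup>2 * \<epsilon>))"
      using \<epsilon> True by (intro mult_left_mono divide_left_mono) auto
    also have "real n / (\<epsilon>\<^sup>2 * \<epsilon>) = real n * e / e ^ 7"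
      using e(1) by (simp add: e(2)[symmetric] eval_nat_numeral)
    also have "\<dots> \<le> w / e ^ 7" using \<open>real n * e \<le> w\<close> e by (intro divide_right_mono) auto
    also have "\<dots> \<le> y" using mult_left_mono[OF \<Lambda>(1), of "w / e ^ 7"] w e by (simp add: y_def)
    finally have "36 * real n / \<epsilon>\<^sup>2 \<le> real m" using m by simp
    then show ?thesis using k \<epsilon> by (intro learning_tester) auto
  qed
  moreover have "real m \<le> 2 ^ 31 * (sqrt (real n * real k) / \<epsilon> powr (7/2)) * (ln (2 + real n + 1 / \<epsilon>)) powr 1"
    using m \<Lambda>(1) by (simp add: y_def w_def powr flip: \<Lambda>_def)
  ultimately show ?thesis by blast
qed

theorem theorem6p3:
  "\<exists>C>0. \<exists>c>0. \<forall>(n::nat) (k::nat) (\<epsilon>::real) (q::nat pmf).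
     1 \<le> k \<longrightarrow> k \<le> n \<longrightarrow> \<epsilon> > 0 \<longrightarrow> dist_on n q \<longrightarrow>
     (\<exists>(m::nat) (A::tester).
        real m \<le> C * (sqrt (real n * real k) / \<epsilon> powr (7/2))
                   * (ln (2 + real n + 1 / \<epsilon>)) powr c \<and>
        (\<forall>p. dist_on n p \<longrightarrow>
           ((\<exists>\<alpha>\<in>{0..1}. \<exists>r. flat_dist n k r \<and> (\<forall>i\<in>{1..n}. pmf p i = mix \<alpha> q r i)) \<longrightarrow>
              pmf (run_tester m A p) Accept \<ge> 2/3) \<and>
           ((\<forall>\<alpha>\<in>{0..1}. \<forall>r. flat_dist n k r \<longrightarrow>
                 l1_norm n (\<lambda>i. pmf p i - mix \<alpha> q r i) \<ge> \<epsilon>) \<longrightarrow>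
              pmf (run_tester m A p) Reject \<ge> 2/3)))"
proof (rule exI[of _ "2 ^ 31"], rule conjI, simp, rule exI[of _ 1], rule conjI, simp, intro allI impI)
  fix n k :: nat and \<epsilon> :: real and q :: "nat pmf"
  assume a: "1 \<le> k" "k \<le> n" "\<epsilon> > 0" "dist_on n q"
  obtain m A where m: "real m \<le> 2 ^ 31 * (sqrt (real n * real k) / \<epsilon> powr (7/2)) * (ln (2 + real n + 1 / \<epsilon>)) powr 1"
    and A: "tests_mixtures n k \<epsilon> q m A"
    using tester_exists[OF a] by blast
  show "\<exists>(m::nat) (A::tester).
        real m \<le> 2 ^ 31 * (sqrt (real n * real k) / \<epsilon> powr (7/2))
                   * (ln (2 + real n + 1 / \<epsilon>)) powr 1 \<and>
        (\<forall>p. dist_on n p \<longrightarrow>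
           ((\<exists>\<alpha>\<in>{0..1}. \<exists>r. flat_dist n k r \<and> (\<forall>i\<in>{1..n}. pmf p i = mix \<alpha> q r i)) \<longrightarrow>
              pmf (run_tester m A p) Accept \<ge> 2/3) \<and>
           ((\<forall>\<alpha>\<in>{0..1}. \<forall>r. flat_dist n k r \<longrightarrow>
                 l1_norm n (\<lambda>i. pmf p i - mix \<alpha> q r i) \<ge> \<epsilon>) \<longrightarrow>
              pmf (run_tester m A p) Reject \<ge> 2/3))"
  proof (intro exI conjI allI impI)
    fix p assume p: "dist_on n p"
    show "2/3 \<le> pmf (run_tester m A p) Accept"
      if "\<exists>\<alpha>\<in>{0..1}. \<exists>r. flat_dist n k r \<and> (\<forall>i\<in>{1..n}. pmf p i = mix \<alpha> q r i)"
      using A p that by (simp add: tests_mixtures_def mixtures_def)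
    show "2/3 \<le> pmf (run_tester m A p) Reject"
      if far: "\<forall>\<alpha>\<in>{0..1}. \<forall>r. flat_dist n k r \<longrightarrow> \<epsilon> \<le> l1_norm n (\<lambda>i. pmf p i - mix \<alpha> q r i)"
    proof -
      have "\<epsilon> \<le> l1_norm n (\<lambda>i. pmf p i - pmf h i)" if h: "h \<in> mixtures n k q" for h
      proof -
        obtain \<alpha> r where r: "\<alpha> \<in> {0..1}" "flat_dist n k r" "\<forall>i\<in>{1..n}. pmf h i = mix \<alpha> q r i"
          using h by (auto simp: mixtures_def)
        have "l1_norm n (\<lambda>i. pmf p i - pmf h i) = l1_norm n (\<lambda>i. pmf p i - mix \<alpha> q r i)"
          unfolding l1_norm_def using r(3) by (intro sum.cong) auto
        then show ?thesis using far r(1,2) by simp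
      qed
      then show ?thesis using A p by (simp add: tests_mixtures_def)
    qed
  qed (rule m)
qed

end
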